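(* Let $T^z=T^z_{m_0,m_1,\ldots,m_{h-1}}$ ($z=1,2$) be a level-wise regular tree of height $h$, let $\mathbf{R}(T^z)$ be its Randić matrix, and let $\psi = \{j : j \in \{1,2,\ldots,h\} \mbox{ and } |L_{h-j+1}| > |L_{h-j}|\}$. Let $P_{h+1}$ be the $(h+1)\times(h+1)$ symmetric tridiagonal matrix with all diagonal entries equal to $0$, with $(j,j+1)$ and $(j+1,j)$ entries equal to $\sqrt{\frac{m_{h-j}-1}{m_{h-j+1}m_{h-j}}}$ for $j=1,2,\ldots,h-1$, and with $(h,h+1)$ and $(h+1,h)$ entries equal to $\sqrt{\frac{1}{m_1}}$. For $j=1,2,\ldots,h$, let $P_j$ be the $j\times j$ leading principal submatrix of $P_{h+1}$. For $z=1,2$, let $P^z_{h+1}$ be the $(h+1)\times(h+1)$ symmetric tridiagonal matrix with the same entries as $P_{h+1}$ except that its $(h,h+1)$ and $(h+1,h)$ entries are $\sqrt{\frac{m_0-1}{m_1m_0}}$ and its $(h+1,h+1)$ entry is $\frac{(-1)^z}{m_0}$. Then (a) $\sigma(\mathbf{R}(T^1))=\left(\bigcup_{j\in\psi} \sigma(P_j) \right) \cup \sigma(P_{h+1})$ and $\sigma(\mathbf{R}(T^2))=\left(\bigcup_{j\in\psi} \sigma(P_j) \right) \cup \sigma(P^1_{h+1}) \cup \sigma(P^2_{h+1})$; (b) the multiplicity of each eigenvalue of the matrix $P_j$ as an eigenvalue of $\mathbf{R}(T^z)$ is at least $|L_{h-j+1}|-|L_{h-j}|$ for $j \in \psi$,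 and at least $1$ for $j=h+1$.
   Context: A level-wise regular tree is a tree rooted at one vertex $r$ (denoted $T^1_{m_0,\ldots,m_{h-1}}$, with $m_0\ge 2$) or at two adjacent vertices $r,r'$ (denoted $T^2_{m_0,\ldots,m_{h-1}}$, with $m_0\ge 3$) in which all vertices at minimum distance $i$ from the root set $C(T^z)$ ($C(T^1)=\{r\}$, $C(T^2)=\{r,r'\}$) have the same degree $m_i$, $0\le i\le h$, where $h$ is the height; vertices at level $h$ have degree $m_h=1$. The layers are $L_i=\{v : \min\{d(v,u): u\in C(T^z)\}=i\}$ for $0\le i\le h$, so $|L_0|=1$, $|L_1|=m_0$ for $T^1$, $|L_0|=2$, $|L_1|=2(m_0-1)$ for $T^2$, and $|L_{i+1}|=(m_i-1)|L_i|$ for $1\le i\le h-1$. The Randić matrix $\mathbf{R}(G)$ of a graph has $(i,j)$-entry $1/\sqrt{d_id_j}$ if $v_i\sim v_j$ and $0$ otherwise; $\sigma(\cdot)$ denotes the spectrum (set of eigenvalues).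
   Formalization: In (b) for j=h+1 and z=2, the matrix P_{h+1} is replaced by P^1_{h+1} and P^2_{h+1}; the literal claim fails for h=2, m=(3,2), where 0 is an eigenvalue of P_3 but not of R(T^2). *)

theory Defs
  imports
    "Graph_Theory.Graph_Theory"
    "Jordan_Normal_Form.Spectral_Radius"
    "Jordan_Normal_Form.DL_Submatrix"
begin

text \<open>
  A finite simple undirected graph is a \<^locale>\<open>pair_graph\<close>: a finite loop-free symmetric digraph
  without parallel arcs, each undirected edge being represented by the two arcs \<open>(u,v)\<close>, \<open>(v,u)\<close>.
\<close>

definition degree :: "'a pair_pre_digraph \<Rightarrow> 'a \<Rightarrow> nat" where
  "degree G v = out_degree (with_proj G) v"

text \<open>
  The predicate \<^const>\<open>tree\<close> of \<open>Graph_Theory\<close> is not suitable here: in a symmetric digraph the two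
  arcs of a single edge already form a directed cycle of length 2. The cycles of the undirected graph
  are the directed cycles of length at least 3.
\<close>

definition undirected_tree :: "'a pair_pre_digraph \<Rightarrow> bool" where
  "undirected_tree G \<longleftrightarrow>
     pair_graph G \<and> Digraph_Component.connected (with_proj G) \<and>
     \<not> (\<exists>p. pre_digraph.cycle (with_proj G) p \<and> 3 \<le> length p)"

text \<open>The usual distance: \<open>\<mu>\<close> is the least cost of a walk, here with every arc of cost 1.\<close>

definition graph_dist :: "'a pair_pre_digraph \<Rightarrow> 'a \<Rightarrow> 'a \<Rightarrow> ereal" where
  "graph_dist G u v = wf_digraph.\<mu> (with_proj G) (\<lambda>_. 1) u v"

definition layer :: "'a pair_pre_digraph \<Rightarrow> 'a set \<Rightarrow> nat \<Rightarrow> 'a set" where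
  "layer G C i = {v \<in> pverts G. (MIN u\<in>C. graph_dist G v u) = ereal (real i)}"

text \<open>
  \<open>levelwise_regular_tree z G C m h\<close>: the graph \<open>G\<close> is a level-wise regular tree
  \<open>T\<^sup>z\<close> with root set \<open>C\<close>, height \<open>h\<close> and level degrees \<open>m 0, \<dots>, m h\<close>.
  The values \<open>m i\<close> for \<open>i > h\<close> are irrelevant; \<open>h \<ge> 1\<close> follows from \<open>m h = 1 \<noteq> m 0\<close>.
\<close>

definition levelwise_regular_tree ::
    "nat \<Rightarrow> 'a pair_pre_digraph \<Rightarrow> 'a set \<Rightarrow> (nat \<Rightarrow> nat) \<Rightarrow> nat \<Rightarrow> bool" where
  "levelwise_regular_tree z G C m h \<longleftrightarrow>
     undirected_tree G \<and>
     ((z = 1 \<and> (\<exists>r \<in> pverts G. C = {r}) \<and> m 0 \<ge> 2) \<or>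
      (z = 2 \<and> (\<exists>r r'. (r, r') \<in> parcs G \<and> C = {r, r'}) \<and> m 0 \<ge> 3)) \<and>
     layer G C h \<noteq> {} \<and> (\<forall>i>h. layer G C i = {}) \<and>
     (\<forall>i\<le>h. \<forall>v \<in> layer G C i. degree G v = m i) \<and>
     m h = 1"

text \<open>The list \<open>vs\<close> is an enumeration \<open>v\<^sub>1, \<dots>, v\<^sub>n\<close> of the vertices of \<open>G\<close>.\<close>

definition randic_matrix :: "'a pair_pre_digraph \<Rightarrow> 'a list \<Rightarrow> real mat" where
  "randic_matrix G vs = mat (length vs) (length vs)
     (\<lambda>(i, j). if (vs ! i, vs ! j) \<in> parcs G
               then 1 / sqrt (real (degree G (vs ! i)) * real (degree G (vs ! j)))
               else 0)"

text \<open>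
  The arguments \<open>d\<close> and \<open>b\<close> are indexed from 1 as in the mathematics: \<open>d j\<close> is the \<open>(j,j)\<close> entry and
  \<open>b j\<close> the \<open>(j,j+1)\<close> and \<open>(j+1,j)\<close> entry. The indices of \<^const>\<open>mat\<close> start at 0.
\<close>

definition sym_tridiagonal :: "nat \<Rightarrow> (nat \<Rightarrow> real) \<Rightarrow> (nat \<Rightarrow> real) \<Rightarrow> real mat" where
  "sym_tridiagonal n d b = mat n n
     (\<lambda>(i, k). if i = k then d (i + 1)
               else if k = i + 1 then b (i + 1)
               else if i = k + 1 then b (k + 1)
               else 0)"

definition off_diag :: "(nat \<Rightarrow> nat) \<Rightarrow> nat \<Rightarrow> nat \<Rightarrow> real" where
  "off_diag m h j = sqrt ((real (m (h - j)) - 1) / (real (m (h - j + 1)) * real (m (h - j))))"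

definition P_full :: "(nat \<Rightarrow> nat) \<Rightarrow> nat \<Rightarrow> real mat" where
  "P_full m h = sym_tridiagonal (h + 1) (\<lambda>_. 0)
     (\<lambda>j. if j = h then sqrt (1 / real (m 1)) else off_diag m h j)"

definition P_lead :: "(nat \<Rightarrow> nat) \<Rightarrow> nat \<Rightarrow> nat \<Rightarrow> real mat" where
  "P_lead m h j = submatrix (P_full m h) {..<j} {..<j}"

definition P_pert :: "(nat \<Rightarrow> nat) \<Rightarrow> nat \<Rightarrow> nat \<Rightarrow> real mat" where
  "P_pert m h z = sym_tridiagonal (h + 1)
     (\<lambda>j. if j = h + 1 then (- 1) ^ z / real (m 0) else 0)
     (\<lambda>j. if j = h then sqrt ((real (m 0) - 1) / (real (m 1) * real (m 0))) else off_diag m h j)"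

definition psi :: "'a pair_pre_digraph \<Rightarrow> 'a set \<Rightarrow> nat \<Rightarrow> nat set" where
  "psi G C h = {j \<in> {1..h}. card (layer G C (h - j + 1)) > card (layer G C (h - j))}"

text \<open>
  The matrices used are real symmetric, so their eigenvalues are all real and
  geometric and algebraic multiplicity coincide.
\<close>

definition eigenvalue_multiplicity :: "real mat \<Rightarrow> real \<Rightarrow> nat" where
  "eigenvalue_multiplicity A x = order x (char_poly A)"

end

theory Submission
  imports Defs
begin

text \<open>
  Writing an eigenvector of the Randic matrix as \<open>F(v) = sqrt(d\<^sub>v) G(v)\<close> turns the eigenvalue equation
  into \<open>\<Sum>\<^sub>w G(w) = x d\<^sub>v G(v)\<close>, the sum being over the neighbours of \<open>v\<close>. If \<open>G\<close> is a solution, its sums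
  over the descendants of a fixed vertex \<open>v\<close> in the successive levels satisfy a three-term recurrence.
  Take \<open>v\<close> of minimal level with a nonzero sum. If \<open>v\<close> is a root, the recurrence is the eigenvalue
  equation of \<open>P\<^sub>h\<^sub>+\<^sub>1\<close>, or, after adding or subtracting the sums of the other root, that of
  \<open>P\<^sup>2\<^sub>h\<^sub>+\<^sub>1\<close> or \<open>P\<^sup>1\<^sub>h\<^sub>+\<^sub>1\<close>. Otherwise all sums of the parent of \<open>v\<close> vanish, so the recurrence is that
  of some \<open>P\<^sub>j\<close>, and \<open>v\<close> has a sibling, so \<open>j \<in> \<psi>\<close>. Conversely, an eigenvector of \<open>P\<^sub>j\<close> is spread level-wise
  over the tree, multiplied by a function on the layer \<open>L\<^sub>h\<^sub>-\<^sub>j\<^sub>+\<^sub>1\<close> that sums to zero over the children of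
  every vertex of \<open>L\<^sub>h\<^sub>-\<^sub>j\<close>; these functions form a space of dimension \<open>|L\<^sub>h\<^sub>-\<^sub>j\<^sub>+\<^sub>1| - |L\<^sub>h\<^sub>-\<^sub>j|\<close>.
\<close>

section \<open>Multiplicity of an eigenvalue from explicit eigenvectors\<close>

text \<open>Replacing the unit vectors with index in \<open>S\<close> by the eigenvectors \<open>E s\<close> gives a basis in which the
  columns of the characteristic matrix with index in \<open>S\<close> are divisible by \<open>X - x\<close>.\<close>

lemma card_le_order_char_poly:
  fixes A :: "'a :: field mat"
  assumes A: "A \<in> carrier_mat n n" and S: "S \<subseteq> {..<n}"
    and E: "\<And>s. s \<in> S \<Longrightarrow> E s \<in> carrier_vec n"
    and eig: "\<And>s. s \<in> S \<Longrightarrow> A *\<^sub>v E s = x \<cdot>\<^sub>v E s"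
    and delta: "\<And>s t. s \<in> S \<Longrightarrow> t \<in> S \<Longrightarrow> E s $ t = (if s = t then 1 else 0)"
  shows "card S \<le> order x (char_poly A)"
proof -
  \<comment> \<open>By \<open>delta\<close> the block of \<open>P\<close> with rows and columns in
    \<open>S\<close> is the identity, so negating the off-diagonal entries of \<open>P\<close> gives
    its inverse \<open>Q\<close>.\<close>
  define P where "P = mat n n (\<lambda>(i, j). if j \<in> S then E j $ i else if i = j then 1 else 0)"
  define Q where "Q = mat n n (\<lambda>(i, j). if i = j then 1 else if j \<in> S then - E j $ i else 0)"
  have P: "P \<in> carrier_mat n n" and Q: "Q \<in> carrier_mat n n"
    by (auto simp: P_def Q_def)
  have PQ: "P * Q = 1\<^sub>m n"
  proof (rule eq_matI)
    fix i j assume ij: "i < dim_row (1\<^sub>m n :: 'a mat)" "j < dim_col (1\<^sub>m n :: 'a mat)"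
    then have i: "i < n" and j: "j < n" by auto
    have "(P * Q) $$ (i, j) = (\<Sum>k<n. P $$ (i, k) * Q $$ (k, j))"
      using i j P Q by (auto simp: scalar_prod_def atLeast0LessThan)
    also have "\<dots> = P $$ (i, j) + (\<Sum>k\<in>{..<n} - {j}. P $$ (i, k) * Q $$ (k, j))"
      using j by (subst sum.remove[of _ j]) (auto simp: Q_def)
    also have "(\<Sum>k\<in>{..<n} - {j}. P $$ (i, k) * Q $$ (k, j)) =
        (\<Sum>k\<in>{..<n} - {j}. if k = i then (if j \<in> S \<and> i \<notin> S then - E j $ i else 0) else 0)"
      using i j delta by (intro sum.cong) (auto simp: P_def Q_def)
    also have "\<dots> = (if i \<noteq> j \<and> j \<in> S \<and> i \<notin> S then - E j $ i else 0)"
      using i by (subst sum.delta) auto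
    finally show "(P * Q) $$ (i, j) = 1\<^sub>m n $$ (i, j)"
      using i j delta by (auto simp: P_def)
  qed (use P Q in auto)
  have QP: "Q * P = 1\<^sub>m n"
    by (rule mat_mult_left_right_inverse[OF P Q PQ])
  define B where "B = Q * (A * P)"
  have B: "B \<in> carrier_mat n n" using A P Q by (auto simp: B_def)
  have B_eq: "B = Q * A * P"
    using assoc_mult_mat[OF Q A P] by (simp add: B_def)
  have "similar_mat_wit B A Q P"
    unfolding similar_mat_wit_def using A P Q B PQ QP B_eq by (auto simp: Let_def)
  then have "similar_mat B A"
    unfolding similar_mat_def by blast
  then have char_eq: "char_poly B = char_poly A"
    by (rule char_poly_similar)
  have colB: "B $$ (i, s) = (if i = s then x else 0)" if s: "s \<in> S" and i: "i < n" for i s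
  proof -
    have sn: "s < n" using S s by auto
    have colP: "col P s = E s"
      using s sn E[OF s] by (intro eq_vecI) (auto simp: P_def)
    have "col B s = Q *\<^sub>v col (A * P) s"
      unfolding B_def using A P Q sn by (intro col_mult2) auto
    also have "col (A * P) s = A *\<^sub>v E s"
      using col_mult2[OF A P sn] colP by simp
    also have "\<dots> = x \<cdot>\<^sub>v E s" by (rule eig[OF s])
    also have "Q *\<^sub>v (x \<cdot>\<^sub>v E s) = x \<cdot>\<^sub>v (Q *\<^sub>v E s)"
      using Q E[OF s] by (rule mult_mat_vec)
    also have "Q *\<^sub>v E s = col (Q * P) s"
      using col_mult2[OF Q P sn] colP by simp
    also have "\<dots> = unit_vec n s" using QP sn by simp
    finally have "col B s = x \<cdot>\<^sub>v unit_vec n s" .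
    then have "col B s $ i = (x \<cdot>\<^sub>v unit_vec n s) $ i" by simp
    then show ?thesis using B i sn by simp
  qed
  define f where "f = (\<lambda>i. if i \<in> S then [:- x, 1:] else 1)"
  \<comment> \<open>\<open>M\<close> is the characteristic matrix of \<open>B\<close> with the
    factor \<open>[:- x, 1:]\<close> taken out of each column in \<open>S\<close>; these factors are
    collected in the diagonal matrix of \<open>f\<close>.\<close>
  define M where "M = mat n n (\<lambda>(i, j). if j \<in> S then (if i = j then 1 else 0)
    else char_poly_matrix B $$ (i, j))"
  have M: "M \<in> carrier_mat n n" by (simp add: M_def)
  have "char_poly_matrix B = M * mat_diag n f"
    unfolding mat_diag_mult_right[OF M]
    by (rule eq_matI) (use B colB in \<open>auto simp: M_def f_def char_poly_matrix_def\<close>)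
  then have "char_poly B = det M * det (mat_diag n f)"
    unfolding char_poly_def using det_mult[OF M mat_diag_dim[of n f]] by simp
  also have "det (mat_diag n f) = prod_list (diag_mat (mat_diag n f))"
    by (rule det_upper_triangular[of _ n]) (auto simp: mat_diag_def upper_triangular_def)
  also have "\<dots> = (\<Prod>i<n. f i)"
    by (simp add: prod_list_diag_prod mat_diag_def atLeast0LessThan)
  also have "\<dots> = [:- x, 1:] ^ card S"
    using S by (simp add: f_def prod.If_cases Int_absorb1)
  finally have "[:- x, 1:] ^ card S dvd char_poly A"
    using char_eq by simp
  moreover have "char_poly A \<noteq> 0"
    using degree_monic_char_poly[OF A] by auto
  ultimately show ?thesis
    by (rule order_max)
qed

section \<open>Eigenvectors of symmetric tridiagonal matrices\<close>

lemma sum_three_point: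
  fixes f :: "nat \<Rightarrow> real"
  assumes "i < n"
  shows "(\<Sum>k<n. if i = k then f k else if k = i + 1 then g k else if i = k + 1 then h k else 0) =
    f i + (if i + 1 < n then g (i + 1) else 0) + (if i = 0 then 0 else h (i - 1))"
proof -
  \<comment> \<open>The sum splits into three one-point sums. The guard \<open>i = 0\<close> is
    there because \<open>i - 1\<close> truncates and would pick up \<open>h 0\<close> in the first
    row.\<close>
  have "(\<Sum>k<n. if i = k then f k else if k = i + 1 then g k else if i = k + 1 then h k else 0) =
    (\<Sum>k<n. (if k = i then f k else 0) + (if k = i + 1 then g k else 0) +
      (if k = i - 1 then (if i = 0 then 0 else h k) else 0))"
    by (rule sum.cong) auto
  also have "\<dots> = f i + (if i + 1 < n then g (i + 1) else 0) + (if i = 0 then 0 else h (i - 1))"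
    using assms by (simp only: sum.distrib sum.delta finite_lessThan) auto
  finally show ?thesis .
qed

text \<open>Indexing an eigenvector from 1 and padding it with zeros at \<open>0\<close> and
  \<open>n + 1\<close> gives the first and last rows the same three-term form as all others.\<close>

lemma spectrum_sym_tridiagonal:
  "x \<in> spectrum (sym_tridiagonal n d b) \<longleftrightarrow>
    (\<exists>u. u 0 = 0 \<and> u (Suc n) = 0 \<and> (\<exists>i\<in>{1..n}. u i \<noteq> 0) \<and>
      (\<forall>i\<in>{1..n}. x * u i = d i * u i + b i * u (i + 1) + b (i - 1) * u (i - 1)))"
  (is "_ \<longleftrightarrow> (\<exists>u. ?P u)")
proof -
  let ?A = "sym_tridiagonal n d b"
  have A: "?A \<in> carrier_mat n n" by (simp add: sym_tridiagonal_def)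
  have mult: "(?A *\<^sub>v vec n (\<lambda>i. u (Suc i))) $ i =
      d (Suc i) * u (Suc i) + b (Suc i) * u (Suc i + 1) + b i * u i"
    if "u 0 = 0" "u (Suc n) = 0" "i < n" for u i
  proof -
    have "(?A *\<^sub>v vec n (\<lambda>i. u (Suc i))) $ i = (\<Sum>k<n. ?A $$ (i, k) * u (Suc k))"
      using that A by (auto simp: scalar_prod_def atLeast0LessThan)
    also have "\<dots> = (\<Sum>k<n. if i = k then d (k + 1) * u (Suc k)
        else if k = i + 1 then b k * u (Suc k) else if i = k + 1 then b (k + 1) * u (Suc k) else 0)"
      using that by (intro sum.cong) (auto simp: sym_tridiagonal_def)
    also have "\<dots> = d (Suc i) * u (Suc i) + b (Suc i) * u (Suc i + 1) + b i * u i"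
    proof (cases "Suc i = n")
      case True
      then show ?thesis using that unfolding sum_three_point[OF \<open>i < n\<close>] by auto
    next
      case False
      then show ?thesis using that unfolding sum_three_point[OF \<open>i < n\<close>] by auto
    qed
    finally show ?thesis .
  qed
  show ?thesis
  proof
    assume "x \<in> spectrum ?A"
    then obtain v where v: "v \<in> carrier_vec n" "v \<noteq> 0\<^sub>v n" "?A *\<^sub>v v = x \<cdot>\<^sub>v v"
      using A by (auto simp: spectrum_def eigenvalue_def eigenvector_def)
    define u where "u i = (if 1 \<le> i \<and> i \<le> n then v $ (i - 1) else 0)" for i
    have vu: "v = vec n (\<lambda>i. u (Suc i))" using v(1) by (auto simp: u_def)
    have u0: "u 0 = 0" "u (Suc n) = 0" by (auto simp: u_def)
    have "\<exists>i<n. v $ i \<noteq> 0"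
      using v(1,2) by (metis eq_vecI carrier_vecD index_zero_vec)
    then obtain i where "i < n" "v $ i \<noteq> 0" by blast
    then have "Suc i \<in> {1..n}" "u (Suc i) \<noteq> 0" by (auto simp: u_def)
    moreover have "x * u i = d i * u i + b i * u (i + 1) + b (i - 1) * u (i - 1)"
      if "i \<in> {1..n}" for i
    proof -
      obtain k where k: "i = Suc k" "k < n" using \<open>i \<in> {1..n}\<close> by (cases i) auto
      have "(?A *\<^sub>v v) $ k = (x \<cdot>\<^sub>v v) $ k" using v(3) by simp
      then show ?thesis
        using mult[OF u0 k(2)] k v(1) by (simp add: vu)
    qed
    ultimately show "\<exists>u. ?P u" using u0 by blast
  next
    assume "\<exists>u. ?P u"
    then obtain u where u: "?P u" by blast
    let ?v = "vec n (\<lambda>i. u (Suc i))"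
    obtain i where i: "i \<in> {1..n}" "u i \<noteq> 0" using u by blast
    then obtain k where k: "i = Suc k" "k < n" by (cases i) auto
    have "?v \<noteq> 0\<^sub>v n"
    proof
      assume "?v = 0\<^sub>v n"
      then have "?v $ k = 0\<^sub>v n $ k" by simp
      then show False using i k by simp
    qed
    moreover have "?A *\<^sub>v ?v = x \<cdot>\<^sub>v ?v"
    proof (rule eq_vecI)
      fix k assume "k < dim_vec (x \<cdot>\<^sub>v ?v)"
      then have k: "k < n" by simp
      moreover have "Suc k \<in> {1..n}" using k by auto
      with u have "x * u (Suc k) = d (Suc k) * u (Suc k) + b (Suc k) * u (Suc k + 1) + b k * u k"
        by fastforce
      ultimately show "(?A *\<^sub>v ?v) $ k = (x \<cdot>\<^sub>v ?v) $ k"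
        using mult[of u k] u by simp
    qed (use A in auto)
    ultimately show "x \<in> spectrum ?A"
      using A by (auto simp: spectrum_def eigenvalue_def eigenvector_def intro!: exI[of _ ?v])
  qed
qed

section \<open>Levels of the tree\<close>

lemma (in wf_digraph) awalk_cost_const_1: "awalk_cost (\<lambda>_. 1) p = real (length p)"
  by (induction p) auto

context pair_wf_digraph
begin

lemma relpow_of_awalk:
  "awalk u p v \<Longrightarrow> (u, v) \<in> parcs G ^^ length p"
  by (induction p arbitrary: u) (auto simp: awalk_simps simp del: relpow.simps(2) intro: relpow_Suc_I2)

lemma awalk_of_relpow:
  assumes "(u, v) \<in> parcs G ^^ n" "u \<in> pverts G"
  obtains p where "awalk u p v" "length p = n"
  using assms
proof (induction n arbitrary: u thesis)
  case 0
  then show ?case by (auto intro: 0(1)[of "[]"] simp: awalk_Nil_iff)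
next
  case (Suc n)
  from relpow_Suc_D2[OF Suc.prems(2)] obtain w
    where w: "(u, w) \<in> parcs G" "(w, v) \<in> parcs G ^^ n" by blast
  then obtain p where "awalk w p v" "length p = n"
    using Suc.IH in_arcsD2 by blast
  then show ?case
    using w by (intro Suc.prems(1)[of "(u, w) # p"]) (auto simp: awalk_Cons_iff)
qed

lemma ge_graph_distI:
  assumes "\<And>k. (u, v) \<in> parcs G ^^ k \<Longrightarrow> n \<le> k"
  shows "ereal (real n) \<le> graph_dist G u v"
  unfolding graph_dist_def \<mu>_def
  by (rule INF_greatest) (auto simp: awalk_cost_const_1 dest!: relpow_of_awalk intro: assms)

lemma graph_dist_leI:
  assumes "(u, v) \<in> parcs G ^^ n" "u \<in> pverts G"
  shows "graph_dist G u v \<le> ereal (real n)"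
proof -
  obtain p where "awalk u p v" "length p = n"
    using awalk_of_relpow assms by blast
  then show ?thesis
    unfolding graph_dist_def using min_cost_le_walk_cost[of u p v "\<lambda>_. 1"]
    by (simp add: awalk_cost_const_1)
qed

lemma awalk_of_rtrancl:
  assumes "(u, v) \<in> R\<^sup>*" "R \<subseteq> parcs G" "u \<in> pverts G"
  shows "\<exists>p. awalk u p v \<and> set p \<subseteq> R"
  using assms(1)
proof (induction rule: rtrancl_induct)
  case base
  then show ?case using assms(3) by (intro exI[of _ "[]"]) (auto simp: awalk_Nil_iff)
next
  case (step w v)
  then obtain p where p: "awalk u p w" "set p \<subseteq> R" by blast
  have "awalk w [(w, v)] v"
    using step assms(2) by (auto simp: awalk_simps dest: in_arcsD2)
  then have "awalk u (p @ [(w, v)]) v" using p by (auto intro: awalk_appendI)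
  then show ?case using p step by (intro exI[of _ "p @ [(w, v)]"]) auto
qed

end

text \<open>A walk from \<open>u\<close> to \<open>v\<close> that avoids the arc
  \<open>(u, v)\<close> shortens to a path of at least two arcs, which the reverse arc
  \<open>(v, u)\<close> closes to a cycle of length at least 3.\<close>

lemma undirected_tree_bridge:
  assumes "undirected_tree G" and "(u, v) \<in> parcs G"
  shows "(u, v) \<notin> (parcs G - {(u, v)})\<^sup>*"
proof
  interpret pair_graph G using assms(1) by (simp add: undirected_tree_def)
  assume *: "(u, v) \<in> (parcs G - {(u, v)})\<^sup>*"
  have u: "u \<in> pverts G" and uv: "u \<noteq> v"
    using assms(2) no_loops' by (auto dest: in_arcsD1)
  obtain p where p: "awalk u p v" "set p \<subseteq> parcs G - {(u, v)}"
    using awalk_of_rtrancl[OF * _ u] by blast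
  define q where "q = awalk_to_apath p"
  have q: "apath u q v" "(u, v) \<notin> set q"
    using apath_awalk_to_apath[OF p(1)] awalk_to_apath_subset[OF p(1)] p(2) by (auto simp: q_def)
  have "q \<noteq> []" using q(1) uv by (auto simp: apath_Nil_iff)
  \<comment> \<open>A path consisting of one arc would be the removed arc itself.\<close>
  moreover have "q \<noteq> [e]" for e
    using q by (auto simp: apath_def awalk_simps)
  ultimately have "2 \<le> length q"
    by (cases q rule: remdups_adj.cases) auto
  moreover have "awalk v ((v, u) # q) v"
    using q(1) assms(2) arcs_symmetric by (auto simp: apath_def awalk_Cons_iff)
  then have "cycle ((v, u) # q)"
    using q(1) by (auto simp: cycle_def apath_def)
  ultimately show False
    using assms(1) by (auto simp: undirected_tree_def)
qed

section \<open>Distance to the root set\<close>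

locale levelwise_tree =
  fixes z :: nat and G :: "'a pair_pre_digraph" and C :: "'a set" and m :: "nat \<Rightarrow> nat" and h :: nat
  assumes regular: "levelwise_regular_tree z G C m h"

sublocale levelwise_tree \<subseteq> pair_graph G
  using regular by (simp add: levelwise_regular_tree_def undirected_tree_def)

context levelwise_tree
begin

abbreviation V where "V \<equiv> pverts G"
abbreviation A where "A \<equiv> parcs G"

lemma tree_G: "undirected_tree G"
  using regular by (simp add: levelwise_regular_tree_def)

lemma z_cases: "z = 1 \<or> z = 2"
  using regular by (auto simp: levelwise_regular_tree_def)

lemma m_h: "m h = 1"
  using regular by (simp add: levelwise_regular_tree_def)

lemma m_0_ge: "m 0 \<ge> z + 1"
  using regular by (auto simp: levelwise_regular_tree_def)

lemma root_set: 
  obtains (one) r where "z = 1" "r \<in> V" "C = {r}"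
  | (two) r r' where "z = 2" "(r, r') \<in> A" "(r', r) \<in> A" "r \<noteq> r'" "r \<in> V" "r' \<in> V" "C = {r, r'}"
proof -
  consider (1) r where "z = 1" "r \<in> V" "C = {r}"
    | (2) r r' where "z = 2" "(r, r') \<in> A" "C = {r, r'}"
    using regular by (auto simp: levelwise_regular_tree_def)
  then show thesis
  proof cases
    case 1
    then show ?thesis by (rule one)
  next
    case 2
    then show ?thesis
      using two[of r r'] arcs_symmetric[of r r'] in_arcsD1[of r r'] in_arcsD2[of r r'] no_loops'[of r r']
      by blast
  qed
qed

lemma root_set_subset: "C \<subseteq> V"
  by (cases rule: root_set) auto

lemma finite_C: "finite C" and C_nonempty: "C \<noteq> {}" and card_C: "card C = z"
  by (cases rule: root_set; simp)+

text \<open>A natural number in place of the \<open>ereal\<close>-valued minimum of distances, so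
  that induction on levels is available; \<open>layer_eq\<close> shows that the two agree on
  vertices.\<close>

definition lev :: "'a \<Rightarrow> nat" where
  "lev v = (LEAST n. \<exists>u\<in>C. (v, u) \<in> A ^^ n)"

lemma ex_relpow_root:
  assumes "v \<in> V"
  shows "\<exists>n. \<exists>u\<in>C. (v, u) \<in> A ^^ n"
proof -
  obtain u where u: "u \<in> C" using C_nonempty by blast
  have "strongly_connected (with_proj G)"
    using symmetric_connected_imp_strongly_connected sym_arcs tree_G
    by (auto simp: undirected_tree_def)
  then have "v \<rightarrow>\<^sup>*\<^bsub>with_proj G\<^esub> u"
    using assms u root_set_subset by (auto simp: strongly_connected_def)
  then obtain p where "awalk v p u" by (auto simp: reachable_awalk)
  then show ?thesis using u relpow_of_awalk by blast
qed

lemma lev_witness: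
  assumes "v \<in> V"
  obtains u where "u \<in> C" "(v, u) \<in> A ^^ lev v"
  using LeastI_ex[OF ex_relpow_root[OF assms]] by (auto simp: lev_def)

lemma lev_le: "u \<in> C \<Longrightarrow> (v, u) \<in> A ^^ n \<Longrightarrow> lev v \<le> n"
  unfolding lev_def by (rule Least_le) blast

lemma layer_eq: "layer G C i = {v \<in> V. lev v = i}"
proof -
  have "(MIN u\<in>C. graph_dist G v u) = ereal (real (lev v))" if v: "v \<in> V" for v
  proof (rule antisym)
    obtain u where "u \<in> C" "(v, u) \<in> A ^^ lev v" using lev_witness[OF v] by blast
    then show "(MIN u\<in>C. graph_dist G v u) \<le> ereal (real (lev v))"
      using finite_C graph_dist_leI[OF _ v] by (subst Min_le_iff) auto
    show "ereal (real (lev v)) \<le> (MIN u\<in>C. graph_dist G v u)"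
      using finite_C C_nonempty by (auto intro!: ge_graph_distI lev_le simp: Min_ge_iff)
  qed
  then show ?thesis by (auto simp: layer_def)
qed

lemma lev_le_h: "v \<in> V \<Longrightarrow> lev v \<le> h"
  using regular by (force simp: levelwise_regular_tree_def layer_eq not_le[symmetric])

lemma lev_eq_0_iff:
  assumes "v \<in> V" shows "lev v = 0 \<longleftrightarrow> v \<in> C"
proof
  assume "lev v = 0"
  then show "v \<in> C" using lev_witness[OF assms] by auto
next
  assume "v \<in> C"
  then show "lev v = 0" using lev_le[of v v 0] by auto
qed

lemma lev_adjacent: 
  assumes "(v, w) \<in> A" shows "lev v \<le> Suc (lev w)"
proof -
  obtain u where "u \<in> C" "(w, u) \<in> A ^^ lev w"
    using assms lev_witness in_arcsD2 by blast
  then show ?thesis using assms by (meson lev_le relpow_Suc_I2)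
qed

text \<open>The first step of a shortest walk to the root set lowers the level by exactly
  one.\<close>

lemma ex_lower_neighbour:
  assumes "v \<in> V" "0 < lev v"
  shows "\<exists>w. (v, w) \<in> A \<and> lev v = Suc (lev w)"
proof -
  obtain n where n: "lev v = Suc n" using assms by (cases "lev v") auto
  obtain u where u: "u \<in> C" "(v, u) \<in> A ^^ Suc n" using lev_witness[OF assms(1)] n by metis
  from relpow_Suc_D2[OF u(2)] obtain w where w: "(v, w) \<in> A" "(w, u) \<in> A ^^ n" by blast
  have "lev w \<le> n" using lev_le[OF u(1) w(2)] .
  with lev_adjacent[OF w(1)] n w show ?thesis by auto
qed

text \<open>Vertices of level at most \<open>k\<close> are connected by these arcs. So an arc to a second lower
  neighbour, or between two non-root vertices of the same level, would close a cycle.\<close>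

definition low_arcs :: "nat \<Rightarrow> 'a rel" where
  "low_arcs k = {(a, b) \<in> A. lev a \<le> k \<and> lev b \<le> k \<and> (lev a \<noteq> lev b \<or> lev a = 0)}"

lemma sym_low_arcs: "sym (low_arcs k)"
  by (auto simp: low_arcs_def sym_def intro: arcs_symmetric)

lemma low_arcs_root:
  assumes "v \<in> V" "lev v \<le> k"
  shows "\<exists>u\<in>C. (v, u) \<in> (low_arcs k)\<^sup>*"
  using assms
proof (induction "lev v" arbitrary: v)
  case 0
  then show ?case using lev_eq_0_iff by auto
next
  case (Suc n)
  obtain w where w: "(v, w) \<in> A" "lev v = Suc (lev w)"
    using ex_lower_neighbour[of v] Suc by auto
  then have "(v, w) \<in> low_arcs k" using Suc.prems by (auto simp: low_arcs_def)
  moreover have "\<exists>u\<in>C. (w, u) \<in> (low_arcs k)\<^sup>*"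
    using Suc w in_arcsD2 by auto
  ultimately show ?case by (meson converse_rtrancl_into_rtrancl)
qed

text \<open>Both vertices descend to roots, and two distinct roots are joined by the root edge,
  which \<open>low_arcs\<close> retains by admitting equal levels at 0.\<close>

lemma low_arcs_connected:
  assumes "v \<in> V" "lev v \<le> k" "w \<in> V" "lev w \<le> k"
  shows "(v, w) \<in> (low_arcs k)\<^sup>*"
proof -
  obtain a b where a: "a \<in> C" "(v, a) \<in> (low_arcs k)\<^sup>*" and b: "b \<in> C" "(w, b) \<in> (low_arcs k)\<^sup>*"
    using low_arcs_root assms by meson
  have "(a, b) \<in> (low_arcs k)\<^sup>*"
  proof (cases "a = b")
    case False
    then have "(a, b) \<in> A"
      using a(1) b(1) by (cases rule: root_set) auto
    moreover have "lev a = 0" "lev b = 0"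
      using a(1) b(1) lev_eq_0_iff root_set_subset by auto
    ultimately have "(a, b) \<in> low_arcs k" by (auto simp: low_arcs_def)
    then show ?thesis by blast
  qed auto
  moreover have "(b, w) \<in> (low_arcs k)\<^sup>*"
    using b(2) sym_low_arcs sym_rtrancl by (metis symD)
  ultimately show ?thesis using a(2) by (meson rtrancl_trans)
qed

text \<open>From \<open>w'\<close> one reaches \<open>w\<close> by arcs between vertices of level at
  most \<open>lev w\<close>, hence without meeting \<open>v\<close>. Going through \<open>w'\<close>
  thus bypasses the bridge \<open>(v, w)\<close>.\<close>

lemma lower_neighbour_unique:
  assumes "(v, w) \<in> A" "(v, w') \<in> A" "lev v = Suc (lev w)" "lev v = Suc (lev w')"
  shows "w = w'"
proof (rule ccontr)
  assume neq: "w \<noteq> w'"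
  have V: "w \<in> V" "w' \<in> V" using assms in_arcsD2 by auto
  have "(w', w) \<in> (low_arcs (lev w))\<^sup>*"
    using V assms by (intro low_arcs_connected) auto
  moreover have "low_arcs (lev w) \<subseteq> A - {(v, w)}"
    using assms by (auto simp: low_arcs_def)
  ultimately have "(w', w) \<in> (A - {(v, w)})\<^sup>*"
    using rtrancl_mono by blast
  then have "(v, w) \<in> (A - {(v, w)})\<^sup>*"
    using assms neq by (auto intro: converse_rtrancl_into_rtrancl)
  then show False using undirected_tree_bridge[OF tree_G assms(1)] by blast
qed

text \<open>At a positive level, \<open>low_arcs\<close> connects \<open>v\<close> to
  \<open>w\<close> but omits the arc \<open>(v, w)\<close>, so this arc would not be a
  bridge.\<close>

lemma same_level_adjacent:
  assumes "(v, w) \<in> A" "lev v = lev w"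
  shows "lev v = 0"
proof (rule ccontr)
  assume neq: "lev v \<noteq> 0"
  have V: "v \<in> V" "w \<in> V" using assms in_arcsD1 in_arcsD2 by auto
  have "(v, w) \<in> (low_arcs (lev v))\<^sup>*"
    using V assms by (intro low_arcs_connected) auto
  moreover have "low_arcs (lev v) \<subseteq> A - {(v, w)}"
    using assms neq by (auto simp: low_arcs_def)
  ultimately have "(v, w) \<in> (A - {(v, w)})\<^sup>*"
    using rtrancl_mono by blast
  then show False using undirected_tree_bridge[OF tree_G assms(1)] by blast
qed


section \<open>Parents, children and sums over descendants\<close>

definition children :: "'a \<Rightarrow> 'a set" where
  "children v = {w. (v, w) \<in> A \<and> lev w = Suc (lev v)}"

definition parent :: "'a \<Rightarrow> 'a" where
  "parent v = (THE w. (v, w) \<in> A \<and> lev v = Suc (lev w))"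

text \<open>A root has \<open>z - 1\<close> neighbours among the roots and any other vertex has one
  parent; the remaining neighbours are children. At level \<open>h\<close> the value is 0.\<close>

definition num_children :: "nat \<Rightarrow> nat" where
  "num_children l = (if l = 0 then m 0 + 1 - z else m l - 1)"

lemma childrenD:
  assumes "w \<in> children v"
  shows "w \<in> V" "lev w = Suc (lev v)" "parent w = v"
proof -
  show "w \<in> V" "lev w = Suc (lev v)"
    using assms in_arcsD2 by (auto simp: children_def)
  show "parent w = v"
    unfolding parent_def
    using assms arcs_symmetric lower_neighbour_unique
    by (intro the_equality) (auto simp: children_def)
qed

lemma parent:
  assumes "v \<in> V" "0 < lev v"
  shows "(v, parent v) \<in> A" "lev v = Suc (lev (parent v))" "parent v \<in> V" "v \<in> children (parent v)"
proof -
  obtain w where w: "(v, w) \<in> A" "lev v = Suc (lev w)"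
    using ex_lower_neighbour assms by blast
  then have child: "v \<in> children w"
    using arcs_symmetric by (auto simp: children_def)
  then have "parent v = w" by (rule childrenD)
  with w child show "(v, parent v) \<in> A" "lev v = Suc (lev (parent v))" "parent v \<in> V"
    "v \<in> children (parent v)"
    using in_arcsD2 by auto
qed

lemma finite_children: "finite (children v)"
  by (rule finite_subset[OF _ pair_finite_verts]) (auto dest: childrenD)

text \<open>Levels of adjacent vertices differ by at most one, equality occurs only between roots,
  and a lower neighbour is the parent. So \<open>U\<close> collects the neighbours that are not
  children.\<close>

lemma neighbours_split:
  assumes "v \<in> V"
  defines "U \<equiv> (if lev v = 0 then C - {v} else {parent v})"
  shows "{w. (v, w) \<in> A} = children v \<union> U" "children v \<inter> U = {}" "finite U"
proof -
  have C0: "lev w = 0 \<longleftrightarrow> w \<in> C" if "(v, w) \<in> A" for w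
    using that lev_eq_0_iff in_arcsD2 by blast
  have "(v, w) \<in> A" if "v \<in> C" "w \<in> C" "w \<noteq> v" for w
    using that by (cases rule: root_set) auto
  then have U: "U \<subseteq> {w. (v, w) \<in> A \<and> lev w \<le> lev v}"
    using parent[OF assms(1)] lev_eq_0_iff[OF assms(1)] C0 by (auto simp: U_def)
  moreover have "w \<in> children v \<union> U" if w: "(v, w) \<in> A" for w
  proof -
    have wv: "(w, v) \<in> A" using w arcs_symmetric by blast
    consider "lev w = Suc (lev v)" | "lev w = lev v" | "lev v = Suc (lev w)"
      using lev_adjacent[OF w] lev_adjacent[OF wv] by linarith
    then show ?thesis
    proof cases
      case 1
      then show ?thesis using w by (simp add: children_def)
    next
      case 2
      then have "lev v = 0" using same_level_adjacent w by metis
      then show ?thesis using 2 C0[OF w] no_loops'[OF w] by (auto simp: U_def)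
    next
      case 3
      then have "v \<in> children w" using wv by (simp add: children_def)
      then show ?thesis using 3 childrenD by (auto simp: U_def)
    qed
  qed
  ultimately show "{w. (v, w) \<in> A} = children v \<union> U"
    by (auto simp: children_def)
  show "children v \<inter> U = {}" using U by (auto simp: children_def)
  show "finite U" using finite_C by (simp add: U_def)
qed

lemma sum_neighbours:
  assumes "v \<in> V"
  shows "(\<Sum>w | (v, w) \<in> A. F w) = (\<Sum>w\<in>children v. F w) +
    (if lev v = 0 then \<Sum>u\<in>C - {v}. F u else (F (parent v) :: real))"
  using neighbours_split[OF assms] finite_children
  by (simp add: sum.union_disjoint)

lemma degree_eq_card: "Defs.degree G v = card {w. (v, w) \<in> A}"
proof -
  have "out_arcs (with_proj G) v = Pair v ` {w. (v, w) \<in> A}"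
    by (auto simp: out_arcs_def)
  then show ?thesis
    by (simp add: Defs.degree_def out_degree_def card_image inj_on_def)
qed

lemma degree_eq: "v \<in> V \<Longrightarrow> Defs.degree G v = m (lev v)"
  using regular lev_le_h by (auto simp: levelwise_regular_tree_def layer_eq)

lemma card_children:
  assumes "v \<in> V" shows "card (children v) = num_children (lev v)"
proof -
  have "m (lev v) = card (children v) + (if lev v = 0 then z - 1 else 1)"
    using neighbours_split[OF assms] finite_children lev_eq_0_iff[OF assms] finite_C card_C
    by (simp add: degree_eq[OF assms, symmetric] degree_eq_card card_Un_disjoint card_Diff_singleton)
  then show ?thesis using z_cases by (auto simp: num_children_def)
qed

lemma finite_layer: "finite (layer G C i)"
  using pair_finite_verts by (simp add: layer_eq)

lemma children_subset_layer: "v \<in> layer G C l \<Longrightarrow> children v \<subseteq> layer G C (Suc l)"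
  by (auto simp: layer_eq dest: childrenD)

text \<open>The sets of children of the vertices in one layer partition the next layer.\<close>

lemma card_layer_Suc: "card (layer G C (Suc l)) = num_children l * card (layer G C l)"
proof -
  have eq: "layer G C (Suc l) = (\<Union>p\<in>layer G C l. children p)"
  proof
    show "layer G C (Suc l) \<subseteq> (\<Union>p\<in>layer G C l. children p)"
    proof
      fix v assume "v \<in> layer G C (Suc l)"
      then have v: "v \<in> V" "lev v = Suc l" by (auto simp: layer_eq)
      then show "v \<in> (\<Union>p\<in>layer G C l. children p)"
        using parent[OF v(1)] by (intro UN_I[of "parent v"]) (auto simp: layer_eq)
    qed
  qed (use children_subset_layer in blast)
  have "card (layer G C (Suc l)) = (\<Sum>p\<in>layer G C l. card (children p))"
    unfolding eq using finite_layer finite_children by (intro card_UN_disjoint) (auto dest: childrenD)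
  also have "\<dots> = (\<Sum>p\<in>layer G C l. num_children l)"
    by (rule sum.cong) (auto simp: layer_eq card_children)
  finally show ?thesis by simp
qed

text \<open>Downward induction from the nonempty layer \<open>h\<close>: by
  \<open>card_layer_Suc\<close> an empty layer forces the next one to be empty.\<close>

lemma layer_nonempty: "l \<le> h \<Longrightarrow> layer G C l \<noteq> {}"
proof (induction rule: inc_induct)
  case base
  then show ?case using regular by (simp add: levelwise_regular_tree_def)
next
  case (step l)
  then show ?case using card_layer_Suc[of l] finite_layer by (auto simp: card_eq_0_iff)
qed

lemma num_children_pos:
  assumes "l < h" shows "0 < num_children l"
proof -
  have "card (layer G C (Suc l)) \<noteq> 0"
    using layer_nonempty[of "Suc l"] assms finite_layer by auto
  then show ?thesis using card_layer_Suc[of l] by (cases "num_children l") auto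
qed

lemma m_pos: "l \<le> h \<Longrightarrow> 0 < m l"
  using num_children_pos[of l] m_0_ge m_h z_cases
  by (cases "l = h"; cases "l = 0") (auto simp: num_children_def)

lemma real_num_children:
  "1 \<le> l \<Longrightarrow> l \<le> h \<Longrightarrow> real (num_children l) = real (m l) - 1"
  using m_pos[of l] by (simp add: num_children_def of_nat_diff)

lemma children_nonempty: "v \<in> V \<Longrightarrow> lev v < h \<Longrightarrow> children v \<noteq> {}"
  using card_children num_children_pos by fastforce

text \<open>The sum of \<open>F\<close> over the descendants of \<open>v\<close> exactly
  \<open>k\<close> levels below \<open>v\<close>. Recursion through the children avoids an explicit
  set of descendants.\<close>

fun dsum :: "('a \<Rightarrow> real) \<Rightarrow> 'a \<Rightarrow> nat \<Rightarrow> real" where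
  "dsum F v 0 = F v"
| "dsum F v (Suc k) = (\<Sum>w\<in>children v. dsum F w k)"

lemma dsum_add: "dsum (\<lambda>w. F w + H w) v k = dsum F v k + dsum H v k"
  by (induction k arbitrary: v) (auto simp: sum.distrib)

lemma dsum_mult: "dsum (\<lambda>w. a * F w) v k = a * dsum F v k"
  by (induction k arbitrary: v) (auto simp: sum_distrib_left)

lemma dsum_cong:
  assumes "v \<in> V" "\<And>w. w \<in> V \<Longrightarrow> lev w = lev v + k \<Longrightarrow> F w = H w"
  shows "dsum F v k = dsum H v k"
  using assms
  by (induction k arbitrary: v) (auto intro!: sum.cong simp: childrenD)

lemma dsum_sum_children: "dsum (\<lambda>w. \<Sum>u\<in>children w. F u) v k = dsum F v (Suc k)"
  by (induction k arbitrary: v) (auto intro!: sum.cong)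

text \<open>Every descendant at depth \<open>k\<close> is counted once for each of its children, and
  their number depends only on the level.\<close>

lemma dsum_parent:
  "v \<in> V \<Longrightarrow> dsum (\<lambda>w. F (parent w)) v (Suc k) = num_children (lev v + k) * dsum F v k"
proof (induction k arbitrary: v)
  case 0
  then show ?case by (simp add: childrenD(3) card_children)
next
  case (Suc k)
  have "dsum (\<lambda>w. F (parent w)) v (Suc (Suc k)) =
      (\<Sum>w\<in>children v. num_children (lev w + k) * dsum F w k)"
    unfolding dsum.simps(2)[of _ v] by (rule sum.cong[OF refl Suc.IH]) (auto dest: childrenD)
  also have "\<dots> = (\<Sum>w\<in>children v. num_children (lev v + Suc k) * dsum F w k)"
    by (rule sum.cong) (auto dest: childrenD)
  finally show ?case by (simp add: sum_distrib_left)
qed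

lemma dsum_beyond: "v \<in> V \<Longrightarrow> h < lev v + k \<Longrightarrow> dsum F v k = 0"
proof (induction k arbitrary: v)
  case 0
  then show ?case using lev_le_h by fastforce
next
  case (Suc k)
  then show ?case by (auto intro!: sum.neutral simp: childrenD)
qed

definition walk_eigenfunction :: "real \<Rightarrow> ('a \<Rightarrow> real) \<Rightarrow> bool" where
  "walk_eigenfunction x F \<longleftrightarrow> (\<forall>v\<in>V. (\<Sum>w | (v, w) \<in> A. F w) = x * m (lev v) * F v)"

lemma walk_eigenfunctionD:
  assumes "walk_eigenfunction x F" "v \<in> V"
  shows "x * m (lev v) * F v = dsum F v 1 +
    (if lev v = 0 then \<Sum>u\<in>C - {v}. F u else F (parent v))"
  using assms sum_neighbours[OF assms(2), of F] by (simp add: walk_eigenfunction_def)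

text \<open>The eigenvalue equation is summed over the descendants at depth \<open>k + 1\<close>.
  They share one degree, and none of them is a root, so only children and parents
  contribute.\<close>

lemma dsum_recurrence:
  fixes x :: real
  assumes "walk_eigenfunction x F" "v \<in> V"
  shows "x * m (lev v + Suc k) * dsum F v (Suc k) =
    dsum F v (Suc (Suc k)) + num_children (lev v + k) * dsum F v k"
proof -
  have "x * m (lev v + Suc k) * dsum F v (Suc k) =
      dsum (\<lambda>w. x * m (lev v + Suc k) * F w) v (Suc k)"
    by (simp only: dsum_mult)
  also have "\<dots> = dsum (\<lambda>w. (\<Sum>u\<in>children w. F u) + F (parent w)) v (Suc k)"
  proof (rule dsum_cong[OF assms(2)])
    fix w assume "w \<in> V" "lev w = lev v + Suc k"
    then show "x * m (lev v + Suc k) * F w = (\<Sum>u\<in>children w. F u) + F (parent w)"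
      using walk_eigenfunctionD[OF assms(1), of w] by simp
  qed
  also have "\<dots> = dsum F v (Suc (Suc k)) + num_children (lev v + k) * dsum F v k"
    by (simp only: dsum_add dsum_sum_children dsum_parent[OF assms(2)])
  finally show ?thesis .
qed

definition ancestor :: "nat \<Rightarrow> 'a \<Rightarrow> 'a" where
  "ancestor t v = (parent ^^ (lev v - t)) v"

lemma ancestor_self: "lev v = t \<Longrightarrow> ancestor t v = v"
  by (simp add: ancestor_def)

lemma ancestor_child: "w \<in> children v \<Longrightarrow> t \<le> lev v \<Longrightarrow> ancestor t w = ancestor t v"
  by (auto simp: ancestor_def childrenD Suc_diff_le funpow_Suc_right simp del: funpow.simps)

lemma ancestor_parent: "v \<in> V \<Longrightarrow> t < lev v \<Longrightarrow> ancestor t (parent v) = ancestor t v"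
  using ancestor_child[of v "parent v" t] parent[of v] by auto

lemma ex_descendant:
  assumes "a \<in> V" "lev a \<le> l" "l \<le> h"
  shows "\<exists>w\<in>V. lev w = l \<and> ancestor (lev a) w = a"
  using assms(2,3)
proof (induction rule: dec_induct)
  case base
  then show ?case using assms(1) ancestor_self by blast
next
  case (step l)
  then obtain w where w: "w \<in> V" "lev w = l" "ancestor (lev a) w = a" by auto
  have "children w \<noteq> {}" using w step by (intro children_nonempty) auto
  then obtain u where "u \<in> children w" by blast
  then show ?case using w step childrenD[of u w] ancestor_child[of u w "lev a"] by auto
qed


section \<open>Tridiagonal matrices\<close>

text \<open>Row \<open>i\<close> of the tridiagonal matrices belongs to level \<open>h + 1 - i\<close>. An eigenvector is rescaled by
  \<open>sqrt(m\<^sub>l w\<^sub>l)\<close> at level \<open>l\<close>, where \<open>w\<^sub>l\<close> is the number of descendants of a root at that level.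
  The entry \<open>e\<close> is the diagonal perturbation in the last row.\<close>

definition level_eigenfunction :: "nat \<Rightarrow> real \<Rightarrow> real \<Rightarrow> (nat \<Rightarrow> real) \<Rightarrow> bool" where
  "level_eigenfunction n e x g \<longleftrightarrow> g 0 = 0 \<and> g (Suc n) = 0 \<and> (\<exists>i\<in>{1..n}. g i \<noteq> 0) \<and>
    (\<forall>i\<in>{1..n}. x * real (m (h + 1 - i)) * g i =
      (if i = n then e else 0) * g i + real (num_children (h + 1 - i)) * g (i - 1) + g (i + 1))"

definition layer_width :: "nat \<Rightarrow> real" where
  "layer_width l = (\<Prod>k<l. real (num_children k))"

lemma layer_width_pos: "l \<le> h \<Longrightarrow> 0 < layer_width l"
  unfolding layer_width_def by (rule prod_pos) (simp add: num_children_pos)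

lemma layer_width_Suc:
  "layer_width (Suc l) = num_children l * layer_width l"
  by (simp add: layer_width_def)

text \<open>Conjugation by the positive diagonal matrix with entries \<open>s i\<close>: after
  division of row \<open>i\<close> by \<open>s i / m (h + 1 - i)\<close>, the coefficient towards
  the root becomes 1 and the one towards the leaves becomes
  \<open>num_children (h + 1 - i)\<close>.\<close>

lemma spectrum_level_eigenfunction:
  assumes n: "n \<le> h + 1"
    and d: "\<And>i. i \<in> {1..n} \<Longrightarrow> d i = (if i = n then e else 0) / m (h + 1 - i)"
    and b: "\<And>i. 1 \<le> i \<Longrightarrow> i < n \<Longrightarrow>
      b i = sqrt (num_children (h - i) / (real (m (h + 1 - i)) * real (m (h - i))))"
  shows "x \<in> spectrum (sym_tridiagonal n d b) \<longleftrightarrow> (\<exists>g. level_eigenfunction n e x g)"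
proof -
  \<comment> \<open>The value 1 at \<open>i = 0\<close> keeps \<open>s\<close> positive everywhere:
    the formula would refer to level \<open>h + 1\<close>, where \<open>m\<close> is unconstrained.
    It only meets the padding \<open>g 0 = 0\<close>.\<close>
  define s where "s i = (if i = 0 then 1 else
    sqrt (m (h + 1 - i) * layer_width (h + 1 - i)))" for i
  have s_pos: "s i > 0" for i
    using m_pos[of "h + 1 - i"] layer_width_pos[of "h + 1 - i"]
    by (auto simp: s_def)
  have up: "b i * s (i + 1) = s i / m (h + 1 - i)" if "1 \<le> i" "i < n" for i
  proof -
    define l where "l = h - i"
    have i: "h + 1 - i = Suc l" "h + 1 - (i + 1) = l" "l < h"
      using that n by (auto simp: l_def)
    have mm: "real (m l) > 0" "real (m (Suc l)) > 0"
      using m_pos i by auto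
    have "b i * s (i + 1) = sqrt (num_children l / (real (m (Suc l)) * real (m l))) *
        sqrt (m l * layer_width l)"
      using b[OF that] i by (simp add: s_def l_def)
    also have "\<dots> = sqrt (num_children l * layer_width l / m (Suc l))"
      using mm by (simp add: real_sqrt_mult[symmetric])
    also have "\<dots> = sqrt (m (Suc l) * (num_children l * layer_width l)) / m (Suc l)"
      using mm(2) by (simp add: real_sqrt_divide real_sqrt_mult field_simps)
    also have "\<dots> = s i / m (h + 1 - i)"
      using that unfolding s_def i by (simp add: layer_width_Suc)
    finally show ?thesis .
  qed
  have down: "b (i - 1) * s (i - 1) = num_children (h + 1 - i) * s i / m (h + 1 - i)"
    if "2 \<le> i" "i \<le> n" for i
  proof -
    define l where "l = h + 1 - i"
    have i: "h + 1 - (i - 1) = Suc l" "h - (i - 1) = l" "l < h"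
      using that n by (auto simp: l_def)
    have mm: "real (m l) > 0" "real (m (Suc l)) > 0" and cc: "real (num_children l) > 0"
      using m_pos num_children_pos i by auto
    have "b (i - 1) * s (i - 1) = sqrt (num_children l / (real (m (Suc l)) * real (m l))) *
        sqrt (m (Suc l) * (num_children l * layer_width l))"
      using b[of "i - 1"] that unfolding s_def i by (simp add: layer_width_Suc)
    also have "\<dots> = sqrt ((real (num_children l))\<^sup>2 * layer_width l / m l)"
      using mm by (simp add: real_sqrt_mult[symmetric] power2_eq_square)
    also have "\<dots> = num_children l * s i / m l"
      using that mm cc unfolding s_def l_def[symmetric]
      by (simp add: real_sqrt_divide real_sqrt_mult field_simps)
    finally show ?thesis by (simp add: l_def)
  qed
  have row: "x * (s i * g i) = d i * (s i * g i) + b i * (s (i + 1) * g (i + 1)) +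
        b (i - 1) * (s (i - 1) * g (i - 1)) \<longleftrightarrow>
      x * m (h + 1 - i) * g i =
        (if i = n then e else 0) * g i + num_children (h + 1 - i) * g (i - 1) + g (i + 1)"
    if g: "g 0 = 0" "g (Suc n) = 0" and i: "i \<in> {1..n}" for g :: "nat \<Rightarrow> real" and i
  proof -
    let ?M = "real (m (h + 1 - i))" and ?c = "real (num_children (h + 1 - i))"
    have M: "?M > 0" using m_pos i by auto
    have 1: "b i * (s (i + 1) * g (i + 1)) = s i / ?M * g (i + 1)"
      using up[of i] i g(2) by (cases "i = n") (auto simp: mult.assoc[symmetric])
    have 2: "b (i - 1) * (s (i - 1) * g (i - 1)) = s i / ?M * (?c * g (i - 1))"
      using down[of i] i g(1) by (cases "i = 1") (auto simp: mult.assoc[symmetric])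
    have 3: "d i * (s i * g i) = s i / ?M * ((if i = n then e else 0) * g i)"
      using d[OF i] by simp
    have 4: "x * (s i * g i) = s i / ?M * (x * ?M * g i)"
      using M by simp
    have "s i / ?M \<noteq> 0" using s_pos[of i] M by simp
    then show ?thesis
      unfolding 1 2 3 4 distrib_left[symmetric] mult_cancel_left by (auto simp: add_ac)
  qed
  show ?thesis
    unfolding spectrum_sym_tridiagonal
  proof
    assume "\<exists>g. level_eigenfunction n e x g"
    then obtain g where g: "level_eigenfunction n e x g" by blast
    then show "\<exists>u. u 0 = 0 \<and> u (Suc n) = 0 \<and> (\<exists>i\<in>{1..n}. u i \<noteq> 0) \<and>
      (\<forall>i\<in>{1..n}. x * u i = d i * u i + b i * u (i + 1) + b (i - 1) * u (i - 1))"
      using row[of g] s_pos unfolding level_eigenfunction_def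
      by (intro exI[of _ "\<lambda>i. s i * g i"]) (auto simp: less_imp_neq[THEN not_sym])
  next
    assume "\<exists>u. u 0 = 0 \<and> u (Suc n) = 0 \<and> (\<exists>i\<in>{1..n}. u i \<noteq> 0) \<and>
      (\<forall>i\<in>{1..n}. x * u i = d i * u i + b i * u (i + 1) + b (i - 1) * u (i - 1))"
    then obtain u where u: "u 0 = 0" "u (Suc n) = 0" "\<exists>i\<in>{1..n}. u i \<noteq> 0"
      "\<forall>i\<in>{1..n}. x * u i = d i * u i + b i * u (i + 1) + b (i - 1) * u (i - 1)" by blast
    define g where "g i = u i / s i" for i
    have "u = (\<lambda>i. s i * g i)"
      using s_pos by (auto simp: g_def less_imp_neq[THEN not_sym])
    then show "\<exists>g. level_eigenfunction n e x g"
      using row[of g] u s_pos unfolding level_eigenfunction_def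
      by (intro exI[of _ g]) (auto simp: g_def less_imp_neq[THEN not_sym])
  qed
qed

text \<open>Sums over descendants carry the factor \<open>num_children\<close> on the side of the
  root. Dividing by \<open>layer_width\<close> turns sums into averages, up to a constant, and moves
  this factor to the side of the leaves.\<close>

lemma level_eigenfunction_of_sums:
  fixes S :: "nat \<Rightarrow> real" and e x :: real
  assumes n: "n \<le> h + 1"
    and S: "S 0 = 0" "S (Suc n) = 0" "\<exists>i\<in>{1..n}. S i \<noteq> 0"
    and rec: "\<And>i. i \<in> {1..n} \<Longrightarrow> x * m (h + 1 - i) * S i =
      (if i = n then e else 0) * S i + S (i - 1) + num_children (h - i) * S (i + 1)"
  shows "\<exists>g. level_eigenfunction n e x g"
proof -
  let ?N = "\<lambda>i. layer_width (h + 1 - i)"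
  define g where "g i = S i / ?N i" for i
  have N: "?N i > 0" if "1 \<le> i" for i
    using layer_width_pos that by simp
  have "x * m (h + 1 - i) * g i =
      (if i = n then e else 0) * g i + num_children (h + 1 - i) * g (i - 1) + g (i + 1)"
    if i: "i \<in> {1..n}" for i
  proof -
    have low: "S (i - 1) = ?N i * (num_children (h + 1 - i) * g (i - 1))"
    proof (cases "i = 1")
      case False
      then have "?N (i - 1) = num_children (h + 1 - i) * ?N i"
        using i n layer_width_Suc[of "h + 1 - i"] by (simp add: Suc_diff_le)
      moreover have "?N (i - 1) > 0" by (rule N) (use i False in auto)
      then have "S (i - 1) = ?N (i - 1) * g (i - 1)" by (simp add: g_def)
      ultimately show ?thesis by (simp only: mult_ac)
    qed (use S in \<open>simp add: g_def\<close>)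
    have high: "num_children (h - i) * S (i + 1) = ?N i * g (i + 1)"
    proof (cases "i = n")
      case False
      then have "?N i = num_children (h - i) * ?N (i + 1)"
        using i n layer_width_Suc[of "h - i"] by (simp add: Suc_diff_le)
      moreover have "?N (i + 1) > 0" by (rule N) simp
      ultimately show ?thesis by (simp add: g_def)
    qed (use S in \<open>simp add: g_def\<close>)
    have mid: "S i = ?N i * g i" using N[of i] i by (simp add: g_def)
    have "?N i * (x * m (h + 1 - i) * g i) = ?N i *
      ((if i = n then e else 0) * g i + num_children (h + 1 - i) * g (i - 1) + g (i + 1))"
      using rec[OF i] unfolding low high mid by (simp add: algebra_simps)
    then show ?thesis using N[of i] i by simp
  qed
  moreover have "\<exists>i\<in>{1..n}. g i \<noteq> 0"
    using S(3) N by (force simp: g_def)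
  ultimately show ?thesis
    using S by (auto simp: level_eigenfunction_def g_def intro!: exI[of _ g])
qed

lemma P_lead_eq:
  assumes "n \<le> h + 1"
  shows "P_lead m h n = sym_tridiagonal n (\<lambda>_. 0)
    (\<lambda>j. if j = h then sqrt (1 / real (m 1)) else off_diag m h j)"
proof -
  have pick: "pick {..<n} i = i" if "i < n" for i
    using pick_card_in_set[of i "{..<n}"] that
    by (simp add: Collect_conj_eq lessThan_def[symmetric] Int_absorb1)
  have "card {i. i < h + 1 \<and> i \<in> {..<n}} = n"
    using assms by (simp add: Collect_conj_eq lessThan_def[symmetric] Int_absorb1)
  then show ?thesis
    using assms pick
    by (intro eq_matI) (auto simp: P_lead_def submatrix_def P_full_def sym_tridiagonal_def)
qed

lemma off_diag_eq:
  "1 \<le> i \<Longrightarrow> i < h \<Longrightarrow>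
    off_diag m h i = sqrt (num_children (h - i) / (real (m (h + 1 - i)) * real (m (h - i))))"
  by (simp add: off_diag_def real_num_children Suc_diff_le)

text \<open>A block of size \<open>n \<le> h\<close> contains only off-diagonal entries with index
  below \<open>h\<close>, so the exceptional entry at \<open>h\<close> does not occur in it.\<close>

lemma spectrum_P_lead:
  assumes "n \<le> h"
  shows "x \<in> spectrum (P_lead m h n) \<longleftrightarrow> (\<exists>g. level_eigenfunction n 0 x g)"
  unfolding P_lead_eq[OF le_SucI[OF assms, simplified Suc_eq_plus1]]
  using assms by (intro spectrum_level_eigenfunction) (auto simp: off_diag_eq)

text \<open>The exceptional entry fits the general pattern: for a single root
  \<open>num_children 0 = m 0\<close>, and the factor \<open>m 0\<close> cancels.\<close>

lemma spectrum_P_full: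
  assumes "z = 1"
  shows "x \<in> spectrum (P_full m h) \<longleftrightarrow> (\<exists>g. level_eigenfunction (h + 1) 0 x g)"
proof -
  have "num_children 0 = m 0" "0 < m 0"
    using assms m_pos[of 0] unfolding num_children_def by auto
  then show ?thesis
    unfolding P_full_def by (intro spectrum_level_eigenfunction) (auto simp: off_diag_eq)
qed

lemma spectrum_P_pert:
  assumes "z = 2"
  shows "x \<in> spectrum (P_pert m h k) \<longleftrightarrow> (\<exists>g. level_eigenfunction (h + 1) ((- 1) ^ k) x g)"
proof -
  have "real (num_children 0) = real (m 0) - 1"
    using assms m_pos[of 0] unfolding num_children_def by (simp add: of_nat_diff)
  then show ?thesis
    unfolding P_pert_def by (intro spectrum_level_eigenfunction) (auto simp: off_diag_eq)
qed


section \<open>Eigenfunctions of the tree\<close>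

text \<open>The level profile \<open>g\<close> is copied into the subtree below each vertex
  \<open>a\<close> of layer \<open>t\<close> with weight \<open>f a\<close>, and is extended by 0
  above that layer. Rows are counted from the leaves, hence the index
  \<open>h + 1 - lev v\<close>.\<close>

definition lift :: "nat \<Rightarrow> ('a \<Rightarrow> real) \<Rightarrow> (nat \<Rightarrow> real) \<Rightarrow> 'a \<Rightarrow> real" where
  "lift t f g v = (if t \<le> lev v then f (ancestor t v) * g (h + 1 - lev v) else 0)"

text \<open>Below layer \<open>t\<close> the equation is a row of the one for \<open>g\<close>. For
  \<open>t > 0\<close> the zero at the parent matches the padding of \<open>g\<close>, and the
  vertices of layer \<open>t - 1\<close> see their children cancel. For \<open>t = 0\<close> the
  other roots supply the term with \<open>e\<close>.\<close>

lemma lift_eigenfunction: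
  assumes t: "t \<le> h" and g: "level_eigenfunction (h + 1 - t) e x g"
    and siblings: "\<And>p. p \<in> V \<Longrightarrow> Suc (lev p) = t \<Longrightarrow> (\<Sum>w\<in>children p. f w) = 0"
    and inner: "0 < t \<Longrightarrow> e = 0"
    and roots: "\<And>v. t = 0 \<Longrightarrow> v \<in> C \<Longrightarrow> (\<Sum>u\<in>C - {v}. f u) = e * f v"
  shows "walk_eigenfunction x (lift t f g)"
  unfolding walk_eigenfunction_def
proof
  let ?F = "lift t f g"
  fix v assume v: "v \<in> V"
  let ?U = "if lev v = 0 then \<Sum>u\<in>C - {v}. ?F u else ?F (parent v)"
  have sum: "(\<Sum>w | (v, w) \<in> A. ?F w) = (\<Sum>w\<in>children v. ?F w) + ?U"
    by (rule sum_neighbours[OF v])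
  have lev_v: "lev v \<le> h" using lev_le_h[OF v] .
  show "(\<Sum>w | (v, w) \<in> A. ?F w) = x * m (lev v) * ?F v"
  proof (cases "t \<le> lev v")
    case True
    define i where "i = h + 1 - lev v"
    define a where "a = f (ancestor t v)"
    have i: "i \<in> {1..h + 1 - t}" "h + 1 - i = lev v" using True lev_v by (auto simp: i_def)
    have "?F w = a * g (i - 1)" if "w \<in> children v" for w
      using that True ancestor_child[of w v t] by (simp add: lift_def a_def i_def childrenD(2))
    then have 1: "(\<Sum>w\<in>children v. ?F w) = num_children (lev v) * (a * g (i - 1))"
      using card_children[OF v] by simp
    \<comment> \<open>Exactly one summand can be nonzero: the first strictly below layer
      \<open>t\<close>, the second on layer \<open>t\<close>, where \<open>g (i + 1)\<close> is
      padding.\<close>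
    have 2: "?U = a * (g (i + 1) + (if i = h + 1 - t then e else 0) * g i)"
    proof (cases "lev v = t")
      case eq: True
      have top: "g (i + 1) = 0" "i = h + 1 - t"
        using g t by (auto simp: i_def eq level_eigenfunction_def)
      show ?thesis
      proof (cases "t = 0")
        case True
        have "v \<in> C" using lev_eq_0_iff[OF v] eq True by simp
        have "?F u = f u * g i" if "u \<in> C" for u
        proof -
          have "lev u = 0" using that root_set_subset lev_eq_0_iff by blast
          then show ?thesis using True eq by (simp add: lift_def i_def ancestor_self)
        qed
        then have "?U = (\<Sum>u\<in>C - {v}. f u * g i)" using eq True by simp
        also have "\<dots> = e * f v * g i"
          using roots[OF True \<open>v \<in> C\<close>] by (simp add: sum_distrib_right[symmetric])
        finally show ?thesis using top eq by (simp add: a_def ancestor_self)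
      next
        case False
        then have "lev v = Suc (lev (parent v))" using parent(2)[OF v] eq by simp
        then have "?U = 0" using eq False by (simp add: lift_def)
        then show ?thesis using top False inner by simp
      qed
    next
      case False
      then have "t < lev v" using True by simp
      moreover from this have "lev v = Suc (lev (parent v))" using parent(2)[OF v] by simp
      moreover have "h + 1 - lev (parent v) = i + 1" using calculation lev_v by (simp add: i_def)
      ultimately have "?U = a * g (i + 1)"
        using ancestor_parent[OF v, of t] by (simp add: lift_def a_def)
      moreover have "i \<noteq> h + 1 - t" using False t lev_v by (simp add: i_def)
      ultimately show ?thesis by simp
    qed
    have "x * m (lev v) * g i =
        (if i = h + 1 - t then e else 0) * g i + num_children (lev v) * g (i - 1) + g (i + 1)"
      using g i unfolding level_eigenfunction_def by metis
    moreover have "?F v = a * g i" using True by (simp add: lift_def a_def i_def)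
    ultimately show ?thesis
      unfolding sum 1 2 by (simp add: algebra_simps)
  next
    case False
    have "(\<Sum>w\<in>children v. ?F w) = 0"
    proof (cases "Suc (lev v) = t")
      case True
      have "(\<Sum>w\<in>children v. ?F w) = (\<Sum>w\<in>children v. f w * g (h + 1 - t))"
        using True by (intro sum.cong) (auto simp: lift_def childrenD(2) ancestor_self)
      also have "\<dots> = 0"
        using siblings[OF v True] by (simp add: sum_distrib_right[symmetric])
      finally show ?thesis .
    next
      case False
      then show ?thesis using \<open>\<not> t \<le> lev v\<close>
        by (intro sum.neutral) (auto simp: lift_def childrenD(2))
    qed
    moreover have "?U = 0"
    proof (cases "lev v = 0")
      case True
      then have "?F u = 0" if "u \<in> C" for u
        using that False root_set_subset lev_eq_0_iff[of u] by (auto simp: lift_def)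
      then show ?thesis using True by simp
    next
      case nz: False
      then have "lev v = Suc (lev (parent v))" using parent(2)[OF v] by simp
      then show ?thesis using nz False by (simp add: lift_def)
    qed
    ultimately show ?thesis using False sum by (simp add: lift_def)
  qed
qed

text \<open>In each sibling set of layer \<open>t\<close> one vertex \<open>first p\<close> is set
  aside. Every other vertex \<open>a\<close>, collected in \<open>N\<close>, gives the weight that
  is 1 at \<open>a\<close> and -1 at its set-aside sibling, hence an eigenfunction. The vertices in
  \<open>S\<close> make these functions visibly independent.\<close>

lemma walk_eigenfunction_lead:
  assumes j: "j \<in> psi G C h" and x: "x \<in> spectrum (P_lead m h j)"
  obtains S E where "S \<subseteq> V" "card S = card (layer G C (h - j + 1)) - card (layer G C (h - j))"
    "\<And>s. s \<in> S \<Longrightarrow> walk_eigenfunction x (E s)"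
    "\<And>s t. s \<in> S \<Longrightarrow> t \<in> S \<Longrightarrow> E s t \<noteq> 0 \<longleftrightarrow> s = t"
proof -
  define t where "t = h - j + 1"
  have jh: "1 \<le> j" "j \<le> h" using j by (auto simp: psi_def)
  then have t: "0 < t" "t \<le> h" "h + 1 - t = j" "h - j = t - 1" by (auto simp: t_def)
  obtain g where g: "level_eigenfunction (h + 1 - t) 0 x g"
    using x spectrum_P_lead[OF jh(2)] t by auto
  then obtain i where i: "i \<in> {1..j}" "g i \<noteq> 0"
    using t by (auto simp: level_eigenfunction_def)
  \<comment> \<open>A level on which the profile \<open>g\<close> does not vanish.\<close>
  define l where "l = h + 1 - i"
  have l: "t \<le> l" "l \<le> h" "h + 1 - l = i" using i t by (auto simp: l_def)
  define first where "first p = (SOME w. w \<in> children p)" for p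
  have first: "first p \<in> children p" if "p \<in> layer G C (t - 1)" for p
    using that children_nonempty[of p] t by (auto simp: first_def layer_eq some_in_eq)
  define N where "N = layer G C t - first ` layer G C (t - 1)"
  have first_inj: "inj_on first (layer G C (t - 1))"
    by (metis first childrenD(3) inj_onI)
  have "first ` layer G C (t - 1) \<subseteq> layer G C t"
    using first children_subset_layer[of _ "t - 1"] t by auto
  then have card_N: "card N = card (layer G C t) - card (layer G C (t - 1))"
    using finite_layer card_image[OF first_inj] by (simp add: N_def card_Diff_subset)
  define f where "f a b = (if b = a then 1 else if b = first (parent a) then - 1 else 0 :: real)"
    for a b
  have f: "(\<Sum>w\<in>children p. f a w) = 0" if a: "a \<in> N" and p: "p \<in> V" "Suc (lev p) = t" for a p
  proof (cases "p = parent a")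
    case True
    have "p \<in> layer G C (t - 1)" using p by (auto simp: layer_eq)
    then have fp: "first p \<in> children p" "a \<noteq> first p"
      using first a by (auto simp: N_def)
    have "a \<in> V" "0 < lev a" using a t by (auto simp: N_def layer_eq)
    then have "a \<in> children p" using parent(4) True by simp
    then have "(\<Sum>w\<in>children p. f a w) = f a a + (f a (first p) + (\<Sum>w\<in>children p - {a} - {first p}. f a w))"
      using fp finite_children by (subst sum.remove[of _ a], simp, simp, subst sum.remove[of _ "first p"]) auto
    also have "(\<Sum>w\<in>children p - {a} - {first p}. f a w) = 0"
      by (intro sum.neutral) (auto simp: f_def True)
    finally show ?thesis using fp by (simp add: f_def True)
  next
    case False
    have "a \<in> V" "0 < lev a" "lev a = t" using a t by (auto simp: N_def layer_eq)
    then have "first (parent a) \<in> children (parent a)"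
      using first parent(2,3)[of a] by (simp add: layer_eq)
    then have "first (parent a) \<notin> children p" "a \<notin> children p"
      using False childrenD(3) by metis+
    then show ?thesis by (intro sum.neutral) (auto simp: f_def)
  qed
  \<comment> \<open>A descendant of \<open>a\<close> on level \<open>l\<close> detects the weight at
    \<open>a\<close>: on these vertices only the eigenfunction belonging to \<open>a\<close> itself
    is nonzero, since no element of \<open>N\<close> is a set-aside sibling.\<close>
  define d where "d a = (SOME w. w \<in> V \<and> lev w = l \<and> ancestor t w = a)" for a
  have d: "d a \<in> V" "lev (d a) = l" "ancestor t (d a) = a" if "a \<in> N" for a
  proof -
    have "a \<in> V" "lev a = t" using that by (auto simp: N_def layer_eq)
    then have "\<exists>w. w \<in> V \<and> lev w = l \<and> ancestor t w = a"
      using ex_descendant[of a l] l by auto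
    from someI_ex[OF this] show "d a \<in> V" "lev (d a) = l" "ancestor t (d a) = a"
      by (auto simp: d_def)
  qed
  have d_inj: "inj_on d N" by (metis d(3) inj_onI)
  show thesis
  proof (rule that[of "d ` N" "\<lambda>s. lift t (f (ancestor t s)) g"])
    show "d ` N \<subseteq> V" using d by blast
    show "card (d ` N) = card (layer G C (h - j + 1)) - card (layer G C (h - j))"
      using card_N card_image[OF d_inj] t by (simp add: t_def[symmetric])
    fix s assume s: "s \<in> d ` N"
    then have aN: "ancestor t s \<in> N" using d by auto
    show "walk_eigenfunction x (lift t (f (ancestor t s)) g)"
      using t f[OF aN] by (intro lift_eigenfunction[OF _ g]) auto
    fix u assume u: "u \<in> d ` N"
    then obtain b where b: "b \<in> N" "u = d b" by blast
    obtain a where a: "a \<in> N" "s = d a" using s by blast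
    have "b \<noteq> first (parent a)"
    proof -
      have "a \<in> V" "0 < lev a" "lev a = t" using a t by (auto simp: N_def layer_eq)
      then have "parent a \<in> layer G C (t - 1)" using parent(2,3)[of a] by (simp add: layer_eq)
      then show ?thesis using b by (auto simp: N_def)
    qed
    then show "lift t (f (ancestor t s)) g u \<noteq> 0 \<longleftrightarrow> s = u"
      using i l d a b inj_on_eq_iff[OF d_inj a(1) b(1)] by (auto simp: lift_def f_def)
  qed
qed

text \<open>By \<open>roots\<close>, \<open>f\<close> is an eigenvector with eigenvalue
  \<open>e\<close> of the graph induced on the root set. The lift is nonzero at a descendant of
  \<open>r\<close> on a level where \<open>g\<close> is nonzero.\<close>

lemma walk_eigenfunction_top:
  assumes g: "level_eigenfunction (h + 1) e x g"
    and roots: "\<And>v. v \<in> C \<Longrightarrow> (\<Sum>u\<in>C - {v}. f u) = e * f v"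
    and nz: "r \<in> C" "f r \<noteq> 0"
  shows "\<exists>F. walk_eigenfunction x F \<and> (\<exists>v\<in>V. F v \<noteq> 0)"
proof -
  obtain i where i: "i \<in> {1..h + 1}" "g i \<noteq> 0"
    using g by (auto simp: level_eigenfunction_def)
  have r: "r \<in> V" "lev r = 0" using nz root_set_subset lev_eq_0_iff by auto
  obtain v where "v \<in> V" "lev v = h + 1 - i" "ancestor 0 v = r"
    using ex_descendant[OF r(1), of "h + 1 - i"] r i by force
  moreover have "h + 1 - (h + 1 - i) = i" using i by auto
  ultimately have "lift 0 f g v \<noteq> 0"
    using i nz by (simp add: lift_def)
  moreover have "walk_eigenfunction x (lift 0 f g)"
    using g roots by (intro lift_eigenfunction) auto
  ultimately show ?thesis using \<open>v \<in> V\<close> by blast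
qed

section \<open>From an eigenfunction of the tree to a tridiagonal matrix\<close>

lemma level_eigenfunction_of_dsum:
  fixes S :: "nat \<Rightarrow> real" and e x :: real
  assumes l: "l \<le> h" and nz: "S k\<^sub>0 \<noteq> 0"
    and beyond: "\<And>k. h < l + k \<Longrightarrow> S k = 0"
    and base: "x * m l * S 0 = e * S 0 + S 1"
    and rec: "\<And>k. x * m (l + Suc k) * S (Suc k) = S (Suc (Suc k)) + num_children (l + k) * S k"
  shows "\<exists>g. level_eigenfunction (h + 1 - l) e x g"
\<comment> \<open>Depth \<open>k\<close> becomes row \<open>h + 1 - l - k\<close>. The explicit 0
  beyond the last row is required because truncated subtraction would return \<open>S 0\<close>
  there.\<close>
proof (rule level_eigenfunction_of_sums[where S = "\<lambda>i. if i \<le> h + 1 - l then S (h + 1 - l - i) else 0"])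
  let ?n = "h + 1 - l"
  have "l + k\<^sub>0 \<le> h" using nz beyond by (meson not_le)
  then show "\<exists>i\<in>{1..?n}. (if i \<le> ?n then S (?n - i) else 0) \<noteq> 0"
    using nz by (intro bexI[of _ "?n - k\<^sub>0"]) auto
  show "(if 0 \<le> ?n then S (?n - 0) else 0) = 0" using beyond l by auto
  fix i assume i: "i \<in> {1..?n}"
  show "x * m (h + 1 - i) * (if i \<le> ?n then S (?n - i) else 0) =
    (if i = ?n then e else 0) * (if i \<le> ?n then S (?n - i) else 0) +
    (if i - 1 \<le> ?n then S (?n - (i - 1)) else 0) +
    num_children (h - i) * (if i + 1 \<le> ?n then S (?n - (i + 1)) else 0)"
  proof (cases "i = ?n")
    case True
    then have "h + 1 - i = l" "?n - (i - 1) = 1" using i l by auto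
    then show ?thesis using True base by simp
  next
    case False
    define k where "k = ?n - i - 1"
    have "?n - i = Suc k" "?n - (i - 1) = Suc (Suc k)" "?n - (i + 1) = k"
      "h + 1 - i = l + Suc k" "h - i = l + k" "i + 1 \<le> ?n"
      using i False l by (auto simp: k_def)
    then show ?thesis using False i rec[of k] by simp
  qed
qed auto

lemma walk_eigenfunction_spectrum:
  assumes F: "walk_eigenfunction x F" and nz: "v\<^sub>0 \<in> V" "F v\<^sub>0 \<noteq> 0"
  shows "(\<exists>j\<in>psi G C h. x \<in> spectrum (P_lead m h j)) \<or>
    (if z = 1 then x \<in> spectrum (P_full m h)
     else x \<in> spectrum (P_pert m h 1) \<union> spectrum (P_pert m h 2))"
proof -
  let ?Q = "\<lambda>l. \<exists>v\<in>V. lev v = l \<and> (\<exists>k. dsum F v k \<noteq> 0)"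
  have ex: "\<exists>l. ?Q l" using nz by (metis dsum.simps(1))
  define l where "l = (LEAST l. ?Q l)"
  obtain v k\<^sub>0 where v: "v \<in> V" "lev v = l" "dsum F v k\<^sub>0 \<noteq> 0"
    using LeastI_ex[OF ex] by (auto simp: l_def)
  have least: "dsum F w k = 0" if "w \<in> V" "lev w < l" for w k
    using not_less_Least[of "lev w" ?Q] that by (auto simp: l_def)
  have lh: "l \<le> h" using lev_le_h v by blast
  have rec: "x * m (l + Suc k) * dsum F w (Suc k) =
      dsum F w (Suc (Suc k)) + num_children (l + k) * dsum F w k" if "w \<in> V" "lev w = l" for w k
    using dsum_recurrence[OF F that(1)] that(2) by simp
  show ?thesis
  proof (cases "l = 0")
    case False
    define p where "p = parent v"
    have p: "p \<in> V" "l = Suc (lev p)" "v \<in> children p"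
      using parent[of v] v False by (auto simp: p_def)
    then have "(\<Sum>w\<in>children p. dsum F w k\<^sub>0) = 0"
      using least[of p "Suc k\<^sub>0"] by simp
    \<comment> \<open>The nonzero sum of \<open>v\<close> must be cancelled by a sibling, so the
      layer of \<open>v\<close> is strictly larger than the one before it.\<close>
    then have "children p \<noteq> {v}" using v(3) by auto
    then have "num_children (lev p) > 1"
      using p finite_children card_children[OF p(1)]
      by (metis card_1_singletonE card_gt_0_iff empty_iff linorder_neqE_nat less_one not_less0 singletonD)
    moreover have "card (layer G C (lev p)) > 0"
      using layer_nonempty[of "lev p"] p lh finite_layer by (simp add: card_gt_0_iff)
    ultimately have "card (layer G C (lev p)) < card (layer G C l)"
      using p by (simp add: card_layer_Suc)
    then have psi: "h + 1 - l \<in> psi G C h"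
      using lh False p by (auto simp: psi_def Suc_diff_le)
    \<comment> \<open>The sum at depth 0 of the parent vanishes as well, which removes the parent
      from the equation at \<open>v\<close>.\<close>
    have "F p = 0" using least[of p 0] p by simp
    then have base: "x * m l * dsum F v 0 = 0 * dsum F v 0 + dsum F v 1"
      using walk_eigenfunctionD[OF F v(1)] v False by (simp add: p_def)
    have "\<exists>g. level_eigenfunction (h + 1 - l) 0 x g"
      by (rule level_eigenfunction_of_dsum[OF lh v(3) _ base rec])
        (use v dsum_beyond in auto)
    then have "x \<in> spectrum (P_lead m h (h + 1 - l))"
      using False by (subst spectrum_P_lead) auto
    then show ?thesis using psi by blast
  next
    case l0: True
    have vC: "v \<in> C" using lev_eq_0_iff v l0 by simp
    show ?thesis
    proof (cases rule: root_set)
      case (one r)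
      have "(\<Sum>u\<in>C - {v}. F u) = 0" using one vC by (intro sum.neutral) auto
      then have base: "x * m l * dsum F v 0 = 0 * dsum F v 0 + dsum F v 1"
        using walk_eigenfunctionD[OF F v(1)] v l0 by simp
      have "\<exists>g. level_eigenfunction (h + 1 - l) 0 x g"
        by (rule level_eigenfunction_of_dsum[OF lh v(3) _ base rec])
          (use v dsum_beyond in auto)
      then show ?thesis using spectrum_P_full one l0 by simp
    next
      case (two r r')
      have rr: "lev r = 0" "lev r' = 0" using two lev_eq_0_iff by auto
      have C: "C - {r} = {r'}" "C - {r'} = {r}" using two by auto
      have top: "x * m 0 * F r = dsum F r 1 + F r'" "x * m 0 * F r' = dsum F r' 1 + F r"
        using walk_eigenfunctionD[OF F, of r] walk_eigenfunctionD[OF F, of r'] two rr C by auto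
      \<comment> \<open>The sums of both roots obey the same linear recurrence, and exchanging the
        roots has eigenvalues 1 and -1. The combination with \<open>e\<close> is an eigenvector of
        this exchange, so the coupling of the roots becomes the diagonal term
        \<open>e\<close>.\<close>
      have sol: "\<exists>g. level_eigenfunction (h + 1 - l) e x g"
        if e: "e = 1 \<or> e = - 1" and nz: "dsum F r k + e * dsum F r' k \<noteq> 0" for e k
      proof (rule level_eigenfunction_of_dsum[where S = "\<lambda>k. dsum F r k + e * dsum F r' k", OF lh nz])
        show "x * m l * (dsum F r 0 + e * dsum F r' 0) =
          e * (dsum F r 0 + e * dsum F r' 0) + (dsum F r 1 + e * dsum F r' 1)"
          using top e l0 by (auto simp: algebra_simps simp del: One_nat_def)
        show "x * m (l + Suc k) * (dsum F r (Suc k) + e * dsum F r' (Suc k)) =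
          dsum F r (Suc (Suc k)) + e * dsum F r' (Suc (Suc k)) +
          num_children (l + k) * (dsum F r k + e * dsum F r' k)" for k
          using rec[of r k] rec[of r' k] rr l0 two e by (auto simp: algebra_simps simp del: dsum.simps)
      qed (use two rr l0 dsum_beyond in auto)
      have "dsum F r k\<^sub>0 \<noteq> 0 \<or> dsum F r' k\<^sub>0 \<noteq> 0" using v vC two by auto
      \<comment> \<open>If sum and difference both vanished, so would both terms. The sum leads to
        \<open>P_pert m h 2\<close> and the difference to \<open>P_pert m h 1\<close>.\<close>
      then consider "dsum F r k\<^sub>0 + 1 * dsum F r' k\<^sub>0 \<noteq> 0" | "dsum F r k\<^sub>0 + (- 1) * dsum F r' k\<^sub>0 \<noteq> 0"
        by fastforce
      then show ?thesis
      proof cases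
        case 1
        then show ?thesis using sol[OF _ 1] spectrum_P_pert[of x 2] two l0 by auto
      next
        case 2
        then show ?thesis using sol[OF _ 2] spectrum_P_pert[of x 1] two l0 by auto
      qed
    qed
  qed
qed

end

section \<open>The Randic matrix\<close>

locale levelwise_tree_enum = levelwise_tree +
  fixes vs :: "'a list"
  assumes distinct_vs: "distinct vs" and set_vs: "set vs = pverts G"
begin

abbreviation N where "N \<equiv> length vs"
abbreviation R where "R \<equiv> randic_matrix G vs"

lemma R_carrier: "R \<in> carrier_mat N N"
  by (simp add: randic_matrix_def)

definition vec_of :: "('a \<Rightarrow> real) \<Rightarrow> real vec" where
  "vec_of F = vec N (\<lambda>i. sqrt (m (lev (vs ! i))) * F (vs ! i))"

lemma vec_of_carrier: "vec_of F \<in> carrier_vec N"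
  by (simp add: vec_of_def)

lemma nth_vs: "i < N \<Longrightarrow> vs ! i \<in> V"
  using set_vs nth_mem by blast

lemma m_lev_pos: "v \<in> V \<Longrightarrow> 0 < real (m (lev v))"
  using m_pos lev_le_h by simp

text \<open>The square root of the degree of \<open>w\<close> in \<open>vec_of\<close> cancels the
  one in the denominator of the matrix entry.\<close>

lemma R_mult_vec_of:
  assumes i: "i < N"
  shows "(R *\<^sub>v vec_of F) $ i = (\<Sum>w | (vs ! i, w) \<in> A. F w) / sqrt (m (lev (vs ! i)))"
proof -
  let ?d = "\<lambda>v. sqrt (real (m (lev v)))"
  let ?f = "\<lambda>w. if (vs ! i, w) \<in> A then F w / ?d (vs ! i) else 0"
  have "(R *\<^sub>v vec_of F) $ i = (\<Sum>k<N. R $$ (i, k) * (?d (vs ! k) * F (vs ! k)))"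
    using i R_carrier by (simp add: scalar_prod_def vec_of_def atLeast0LessThan)
  also have "\<dots> = (\<Sum>k<N. ?f (vs ! k))"
    using i nth_vs m_lev_pos
    by (intro sum.cong)
      (auto simp: randic_matrix_def degree_eq real_sqrt_mult less_imp_neq[THEN not_sym])
  also have "\<dots> = (\<Sum>w\<in>V. ?f w)"
    using sum.reindex_bij_betw[OF bij_betw_nth[OF distinct_vs refl set_vs[symmetric]], of ?f]
    by simp
  also have "\<dots> = (\<Sum>w\<in>{w. (vs ! i, w) \<in> A}. F w / ?d (vs ! i))"
    using pair_finite_verts
    by (intro sum.mono_neutral_cong_right) (auto dest: in_arcsD2)
  finally show ?thesis by (simp add: sum_divide_distrib)
qed

lemma R_mult_vec_of_eq_iff: "R *\<^sub>v vec_of F = x \<cdot>\<^sub>v vec_of F \<longleftrightarrow> walk_eigenfunction x F"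
proof -
  have row: "(R *\<^sub>v vec_of F) $ i = (x \<cdot>\<^sub>v vec_of F) $ i \<longleftrightarrow>
      (\<Sum>w | (vs ! i, w) \<in> A. F w) = x * m (lev (vs ! i)) * F (vs ! i)" if i: "i < N" for i
  proof -
    have pos: "0 < real (m (lev (vs ! i)))" using m_lev_pos nth_vs i by blast
    have "(x \<cdot>\<^sub>v vec_of F) $ i = x * (sqrt (m (lev (vs ! i))) * F (vs ! i))"
      using i by (simp add: vec_of_def)
    then show ?thesis
      unfolding R_mult_vec_of[OF i] using pos by (simp add: divide_eq_eq) (simp add: mult_ac)
  qed
  have "R *\<^sub>v vec_of F = x \<cdot>\<^sub>v vec_of F \<longleftrightarrow>
      (\<forall>i<N. (R *\<^sub>v vec_of F) $ i = (x \<cdot>\<^sub>v vec_of F) $ i)"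
    using R_carrier by (auto simp: vec_eq_iff vec_of_def)
  also have "\<dots> \<longleftrightarrow> walk_eigenfunction x F"
    using row by (auto simp: walk_eigenfunction_def set_vs[symmetric] all_set_conv_all_nth)
  finally show ?thesis .
qed

lemma mem_spectrum_iff:
  "x \<in> spectrum R \<longleftrightarrow> (\<exists>F. walk_eigenfunction x F \<and> (\<exists>v\<in>V. F v \<noteq> 0))"
proof
  assume "x \<in> spectrum R"
  then obtain u where u: "u \<in> carrier_vec N" "u \<noteq> 0\<^sub>v N" "R *\<^sub>v u = x \<cdot>\<^sub>v u"
    using R_carrier by (auto simp: spectrum_def eigenvalue_def eigenvector_def)
  \<comment> \<open>This inverts \<open>vec_of\<close>; the description operator finds the position
    of \<open>v\<close> in the enumeration.\<close>
  define F where "F v = u $ (THE i. i < N \<and> vs ! i = v) / sqrt (m (lev v))" for v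
  have F: "F (vs ! i) = u $ i / sqrt (m (lev (vs ! i)))" if "i < N" for i
  proof -
    have "(THE k. k < N \<and> vs ! k = vs ! i) = i"
      using that distinct_vs by (auto simp: nth_eq_iff_index_eq)
    then show ?thesis by (simp add: F_def)
  qed
  have uF: "u = vec_of F"
    using u(1) F m_lev_pos nth_vs
    by (intro eq_vecI) (auto simp: vec_of_def less_imp_neq[THEN not_sym])
  have "\<exists>i<N. u $ i \<noteq> 0"
    using u(1,2) by (metis eq_vecI carrier_vecD index_zero_vec)
  then obtain i where i: "i < N" "u $ i \<noteq> 0" by blast
  then have "F (vs ! i) \<noteq> 0" using F m_lev_pos nth_vs by fastforce
  then show "\<exists>F. walk_eigenfunction x F \<and> (\<exists>v\<in>V. F v \<noteq> 0)"
    using u(3) uF R_mult_vec_of_eq_iff i nth_vs by blast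
next
  assume "\<exists>F. walk_eigenfunction x F \<and> (\<exists>v\<in>V. F v \<noteq> 0)"
  then obtain F v where F: "walk_eigenfunction x F" "v \<in> V" "F v \<noteq> 0" by blast
  then obtain i where i: "i < N" "vs ! i = v"
    using set_vs by (metis in_set_conv_nth)
  then have "vec_of F $ i \<noteq> 0"
    using F m_lev_pos[of v] by (simp add: vec_of_def)
  then have "vec_of F \<noteq> 0\<^sub>v N" using i by auto
  then show "x \<in> spectrum R"
    using R_carrier F R_mult_vec_of_eq_iff vec_of_carrier
    by (auto simp: spectrum_def eigenvalue_def eigenvector_def intro!: exI[of _ "vec_of F"])
qed

text \<open>After scaling, the vectors of the functions \<open>E s\<close> restrict to unit vectors
  on the positions of \<open>S\<close>, which is the situation of
  \<open>card_le_order_char_poly\<close>.\<close>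

lemma card_le_multiplicity:
  assumes S: "S \<subseteq> V" and E: "\<And>s. s \<in> S \<Longrightarrow> walk_eigenfunction x (E s)"
    and nz: "\<And>s t. s \<in> S \<Longrightarrow> t \<in> S \<Longrightarrow> E s t \<noteq> 0 \<longleftrightarrow> s = t"
  shows "card S \<le> eigenvalue_multiplicity R x"
proof -
  define I where "I = {i. i < N \<and> vs ! i \<in> S}"
  \<comment> \<open>The factor that normalises entry \<open>i\<close> of the vector of
    \<open>E (vs ! i)\<close> to 1.\<close>
  define c where "c i = 1 / (sqrt (m (lev (vs ! i))) * E (vs ! i) (vs ! i))" for i
  have "(!) vs ` I = S"
    using S set_vs by (auto simp: I_def in_set_conv_nth image_iff) (metis in_set_conv_nth subsetD)
  moreover have "inj_on ((!) vs) I"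
    using distinct_vs by (auto simp: I_def inj_on_def nth_eq_iff_index_eq)
  ultimately have card: "card S = card I" using card_image by metis
  have "card I \<le> order x (char_poly R)"
  proof (rule card_le_order_char_poly[OF R_carrier, where E = "\<lambda>i. c i \<cdot>\<^sub>v vec_of (E (vs ! i))"])
    show "I \<subseteq> {..<N}" by (auto simp: I_def)
    show "c i \<cdot>\<^sub>v vec_of (E (vs ! i)) \<in> carrier_vec N" for i
      by (simp add: vec_of_carrier)
    fix i assume i: "i \<in> I"
    then have "R *\<^sub>v vec_of (E (vs ! i)) = x \<cdot>\<^sub>v vec_of (E (vs ! i))"
      using E by (simp add: R_mult_vec_of_eq_iff I_def)
    then show "R *\<^sub>v (c i \<cdot>\<^sub>v vec_of (E (vs ! i))) = x \<cdot>\<^sub>v (c i \<cdot>\<^sub>v vec_of (E (vs ! i)))"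
      using mult_mat_vec[OF R_carrier vec_of_carrier]
      by (simp add: smult_smult_assoc mult.commute)
    fix k assume k: "k \<in> I"
    have "E (vs ! i) (vs ! k) \<noteq> 0 \<longleftrightarrow> i = k"
      using i k nz distinct_vs by (auto simp: I_def nth_eq_iff_index_eq)
    then show "(c i \<cdot>\<^sub>v vec_of (E (vs ! i))) $ k = (if i = k then 1 else 0)"
      using i k m_lev_pos[OF nth_vs, of i]
      by (auto simp: I_def vec_of_def c_def)
  qed
  then show ?thesis using card by (simp add: eigenvalue_multiplicity_def)
qed

lemma multiplicity_lead:
  assumes "j \<in> psi G C h" "x \<in> spectrum (P_lead m h j)"
  shows "card (layer G C (h - j + 1)) - card (layer G C (h - j)) \<le> eigenvalue_multiplicity R x"
proof -
  obtain S E where S: "S \<subseteq> V" "card S = card (layer G C (h - j + 1)) - card (layer G C (h - j))"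
    "\<And>s. s \<in> S \<Longrightarrow> walk_eigenfunction x (E s)"
    "\<And>s t. s \<in> S \<Longrightarrow> t \<in> S \<Longrightarrow> E s t \<noteq> 0 \<longleftrightarrow> s = t"
    by (rule walk_eigenfunction_lead[OF assms]) blast
  have "card S \<le> eigenvalue_multiplicity R x"
    by (rule card_le_multiplicity[OF S(1) S(3) S(4)])
  then show ?thesis using S(2) by simp
qed

lemma multiplicity_pos:
  assumes "x \<in> spectrum R" shows "1 \<le> eigenvalue_multiplicity R x"
proof -
  have "poly (char_poly R) x = 0"
    using assms eigenvalue_root_char_poly[OF R_carrier, of x] by (simp add: spectrum_def)
  moreover have "char_poly R \<noteq> 0"
    using degree_monic_char_poly[OF R_carrier] by auto
  ultimately show ?thesis
    using order_root[of "char_poly R" x] by (simp add: eigenvalue_multiplicity_def)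
qed

text \<open>Membership in \<open>psi\<close> makes the multiplicity bound positive, so
  \<open>x\<close> is a root of the characteristic polynomial.\<close>

lemma spectrum_lead_subset:
  assumes "j \<in> psi G C h"
  shows "spectrum (P_lead m h j) \<subseteq> spectrum R"
proof
  fix x assume x: "x \<in> spectrum (P_lead m h j)"
  have "0 < card (layer G C (h - j + 1)) - card (layer G C (h - j))"
    using assms by (simp add: psi_def)
  then have "eigenvalue_multiplicity R x \<noteq> 0"
    using multiplicity_lead[OF assms x] by linarith
  then show "x \<in> spectrum R"
    using eigenvalue_root_char_poly[OF R_carrier, of x] order_0I[of "char_poly R" x]
    by (auto simp: spectrum_def eigenvalue_multiplicity_def)
qed

lemma spectrum_full_subset:
  assumes "z = 1"
  shows "spectrum (P_full m h) \<subseteq> spectrum R"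
proof
  fix x assume "x \<in> spectrum (P_full m h)"
  then obtain g where g: "level_eigenfunction (h + 1) 0 x g"
    using spectrum_P_full[OF assms] by blast
  show "x \<in> spectrum R"
  proof (cases rule: root_set)
    case (one r)
    then have "\<exists>F. walk_eigenfunction x F \<and> (\<exists>v\<in>V. F v \<noteq> 0)"
      by (intro walk_eigenfunction_top[OF g, of "\<lambda>_. 1" r]) auto
    then show ?thesis by (simp add: mem_spectrum_iff)
  qed (use assms in simp)
qed

lemma spectrum_pert_subset:
  assumes "z = 2"
  shows "spectrum (P_pert m h k) \<subseteq> spectrum R"
proof
  fix x assume "x \<in> spectrum (P_pert m h k)"
  then obtain g where g: "level_eigenfunction (h + 1) ((- 1) ^ k) x g"
    using spectrum_P_pert[OF assms] by blast
  show "x \<in> spectrum R"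
  proof (cases rule: root_set)
    case (two r r')
    have C: "C - {r} = {r'}" "C - {r'} = {r}" using two by auto
    \<comment> \<open>The eigenvector of the root edge for the eigenvalue \<open>(- 1) ^ k\<close>:
      symmetric for even \<open>k\<close>, antisymmetric for odd \<open>k\<close>.\<close>
    let ?f = "\<lambda>u. if u = r then 1 else (- 1) ^ k :: real"
    have sq: "(- 1) ^ k * (- 1) ^ k = (1 :: real)"
      by (simp add: power_mult_distrib[symmetric])
    have "(\<Sum>u\<in>C - {v}. ?f u) = (- 1) ^ k * ?f v" if "v \<in> C" for v
    proof -
      have "v = r \<or> v = r'" using that two by auto
      then show ?thesis
      proof
        assume "v = r"
        then show ?thesis using \<open>r \<noteq> r'\<close> by (simp add: C(1))
      next
        assume "v = r'"
        then show ?thesis using \<open>r \<noteq> r'\<close> sq by (simp add: C(2))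
      qed
    qed
    then have "\<exists>F. walk_eigenfunction x F \<and> (\<exists>v\<in>V. F v \<noteq> 0)"
      using two by (intro walk_eigenfunction_top[OF g, of ?f r]) auto
    then show ?thesis by (simp add: mem_spectrum_iff)
  qed (use assms in simp)
qed

lemma spectrum_subset:
  "spectrum R \<subseteq> (\<Union>j\<in>psi G C h. spectrum (P_lead m h j)) \<union>
    (if z = 1 then spectrum (P_full m h) else spectrum (P_pert m h 1) \<union> spectrum (P_pert m h 2))"
proof
  fix x assume "x \<in> spectrum R"
  then obtain F v where "walk_eigenfunction x F" "v \<in> V" "F v \<noteq> 0"
    by (auto simp: mem_spectrum_iff)
  from walk_eigenfunction_spectrum[OF this]
  show "x \<in> (\<Union>j\<in>psi G C h. spectrum (P_lead m h j)) \<union>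
    (if z = 1 then spectrum (P_full m h) else spectrum (P_pert m h 1) \<union> spectrum (P_pert m h 2))"
    by (auto split: if_splits)
qed

lemma spectrum_eq_one:
  assumes "z = 1"
  shows "spectrum R = (\<Union>j\<in>psi G C h. spectrum (P_lead m h j)) \<union> spectrum (P_full m h)"
proof
  show "spectrum R \<subseteq> (\<Union>j\<in>psi G C h. spectrum (P_lead m h j)) \<union> spectrum (P_full m h)"
    using spectrum_subset unfolding if_P[OF assms] .
qed (intro Un_least UN_least spectrum_lead_subset spectrum_full_subset assms)

lemma spectrum_eq_two:
  assumes "z = 2"
  shows "spectrum R = (\<Union>j\<in>psi G C h. spectrum (P_lead m h j)) \<union>
    spectrum (P_pert m h 1) \<union> spectrum (P_pert m h 2)"
proof
  have "z \<noteq> 1" using assms by simp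
  then show "spectrum R \<subseteq> (\<Union>j\<in>psi G C h. spectrum (P_lead m h j)) \<union>
      spectrum (P_pert m h 1) \<union> spectrum (P_pert m h 2)"
    using spectrum_subset by (simp only: if_False Un_assoc)
qed (intro Un_least UN_least spectrum_lead_subset spectrum_pert_subset assms)

end

theorem theorem3p1:
  fixes G :: "'a pair_pre_digraph" and C :: "'a set" and vs :: "'a list"
    and m :: "nat \<Rightarrow> nat" and h z :: nat
  assumes "levelwise_regular_tree z G C m h"
    and "distinct vs" and "set vs = pverts G"
  shows
    "(z = 1 \<longrightarrow>
        spectrum (randic_matrix G vs) =
          (\<Union>j\<in>psi G C h. spectrum (P_lead m h j)) \<union> spectrum (P_full m h)) \<and>
     (z = 2 \<longrightarrow>
        spectrum (randic_matrix G vs) =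
          (\<Union>j\<in>psi G C h. spectrum (P_lead m h j)) \<union>
            spectrum (P_pert m h 1) \<union> spectrum (P_pert m h 2)) \<and>
     (\<forall>j\<in>psi G C h. \<forall>x\<in>spectrum (P_lead m h j).
        eigenvalue_multiplicity (randic_matrix G vs) x
          \<ge> card (layer G C (h - j + 1)) - card (layer G C (h - j))) \<and>
     (z = 1 \<longrightarrow>
        (\<forall>x\<in>spectrum (P_full m h). eigenvalue_multiplicity (randic_matrix G vs) x \<ge> 1)) \<and>
     (z = 2 \<longrightarrow>
        (\<forall>x\<in>spectrum (P_pert m h 1) \<union> spectrum (P_pert m h 2).
           eigenvalue_multiplicity (randic_matrix G vs) x \<ge> 1))"
proof -
  interpret levelwise_tree_enum z G C m h vs
    using assms by (intro levelwise_tree_enum.intro levelwise_tree.intro levelwise_tree_enum_axioms.intro)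
  show ?thesis
  proof (intro conjI impI ballI)
    show "1 \<le> eigenvalue_multiplicity R x" if "z = 1" "x \<in> spectrum (P_full m h)" for x
      using that spectrum_full_subset by (intro multiplicity_pos) blast
    show "1 \<le> eigenvalue_multiplicity R x"
      if "z = 2" "x \<in> spectrum (P_pert m h 1) \<union> spectrum (P_pert m h 2)" for x
      using that spectrum_pert_subset by (intro multiplicity_pos) blast
  qed (fact spectrum_eq_one spectrum_eq_two multiplicity_lead)+
qed

end
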